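(* Let $M = M_1 \ast_N M_2$ where $M_1$ and $M_2$ are E-unitary inverse monoids and $N$ is an inverse submonoid of both $M_1$ and $M_2$. If $N \subseteq U_{M_1} \cap U_{M_2}$ (that is, the copy of $N$ in each $M_i$ consists of units of $M_i$), then $M$ is E-unitary. Further, if $M_1$ and $M_2$ have finite special inverse monoid presentations and $N$ is finitely generated, then $M$ has a finite special inverse monoid presentation.
   Context: $U_{M}$ denotes the group of units of an inverse monoid $M$. Let $\sigma$ be the minimum group congruence on $M$ (the smallest congruence such that $M/\sigma$ is a group); $M$ is E-unitary if an element of $M$ is $\sigma$-related to $1$ if and only if it is idempotent. $M_1 \ast_N M_2$ is the free product with amalgamation in the category of inverse monoids (the pushout of $M_1 \leftarrow N \rightarrow M_2$): if $M_1 = \mathrm{Inv}\langle X_1 \mid R_1\rangle$, $M_2 = \mathrm{Inv}\langle X_2 \mid R_2 \rangle$ with $X_1 \cap X_2=\emptyset$, and the generators of $N$ are represented by words $u_i$ over $X_1\cup X_1^{-1}$ in $M_1$ and correspondingly by words $v_i$ over $X_2 \cup X_2^{-1}$ in $M_2$, then $M_1 \ast_N M_2 = \mathrm{Inv}\langle X_1, X_2 \mid R_1, R_2, u_i = v_i \text{ for all } i\rangle$. Here $\mathrm{Inv}\langle X \mid R\rangle$ is the inverse monoid with generators $X$ and defining relations $R$ (relations between words over $X\cup X^{-1}$). A presentation $\mathrm{Inv}\langle X \mid R\rangle$ is special if all its defining relations have the form $w = 1$, and finite if $X$ and $R$ are finite. *)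

theory Defs
  imports "HOL-Algebra.Group"
begin

section \<open>Inverse monoids\<close>

locale inverse_monoid = monoid G for G (structure) +
  assumes ex1_inverse:
    "x \<in> carrier G \<Longrightarrow> \<exists>!y. y \<in> carrier G \<and> x \<otimes> y \<otimes> x = x \<and> y \<otimes> x \<otimes> y = y"

text \<open>The generalised inverse; the library's \<open>m_inv\<close> is the two-sided inverse of a unit.\<close>

definition minv :: "('a, 'm) monoid_scheme \<Rightarrow> 'a \<Rightarrow> 'a" where
  "minv G x = (THE y. y \<in> carrier G \<and> x \<otimes>\<^bsub>G\<^esub> y \<otimes>\<^bsub>G\<^esub> x = x \<and> y \<otimes>\<^bsub>G\<^esub> x \<otimes>\<^bsub>G\<^esub> y = y)"

text \<open>The library's \<open>hom\<close> does not ask for the identity to be preserved.\<close>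

definition mon_hom :: "('a, 'm) monoid_scheme \<Rightarrow> ('b, 'n) monoid_scheme \<Rightarrow> ('a \<Rightarrow> 'b) set" where
  "mon_hom G H = {h \<in> hom G H. h \<one>\<^bsub>G\<^esub> = \<one>\<^bsub>H\<^esub>}"

definition inverse_submonoid :: "'a set \<Rightarrow> ('a, 'm) monoid_scheme \<Rightarrow> bool" where
  "inverse_submonoid H G \<longleftrightarrow>
     H \<subseteq> carrier G \<and> \<one>\<^bsub>G\<^esub> \<in> H \<and> (\<forall>x\<in>H. \<forall>y\<in>H. x \<otimes>\<^bsub>G\<^esub> y \<in> H) \<and> (\<forall>x\<in>H. minv G x \<in> H)"

definition finitely_generated :: "('a, 'm) monoid_scheme \<Rightarrow> bool" where
  "finitely_generated G \<longleftrightarrow>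
     (\<exists>A. finite A \<and> A \<subseteq> carrier G \<and> \<Inter>{H. inverse_submonoid H G \<and> A \<subseteq> H} = carrier G)"

section \<open>Congruences and E-unitarity\<close>

definition mon_congruence :: "('a, 'm) monoid_scheme \<Rightarrow> ('a \<times> 'a) set \<Rightarrow> bool" where
  "mon_congruence G r \<longleftrightarrow> equiv (carrier G) r \<and>
     (\<forall>a b c d. (a, b) \<in> r \<longrightarrow> (c, d) \<in> r \<longrightarrow> (a \<otimes>\<^bsub>G\<^esub> c, b \<otimes>\<^bsub>G\<^esub> d) \<in> r)"

definition quot_monoid :: "('a, 'm) monoid_scheme \<Rightarrow> ('a \<times> 'a) set \<Rightarrow> 'a set monoid" where
  "quot_monoid G r =
     \<lparr>carrier = carrier G // r,
      mult = (\<lambda>A B. \<Union>a\<in>A. \<Union>b\<in>B. r `` {a \<otimes>\<^bsub>G\<^esub> b}),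
      one = r `` {\<one>\<^bsub>G\<^esub>}\<rparr>"

definition group_congruence :: "('a, 'm) monoid_scheme \<Rightarrow> ('a \<times> 'a) set \<Rightarrow> bool" where
  "group_congruence G r \<longleftrightarrow> mon_congruence G r \<and> group (quot_monoid G r)"

text \<open>On an inverse monoid this intersection is itself a group congruence, hence the smallest one;
  see \<open>min_group_cong_least\<close> below.\<close>

definition min_group_cong :: "('a, 'm) monoid_scheme \<Rightarrow> ('a \<times> 'a) set" where
  "min_group_cong G = \<Inter>{r. group_congruence G r}"

locale E_unitary = inverse_monoid +
  assumes sigma_one_iff_idem:
    "x \<in> carrier G \<Longrightarrow> (x, \<one>) \<in> min_group_cong G \<longleftrightarrow> x \<otimes> x = x"

section \<open>Presentations\<close>

text \<open>Words over $X \cup X^{-1}$: the letter \<open>(x, True)\<close> is $x$ and \<open>(x, False)\<close> is $x^{-1}$.\<close>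

type_synonym 'x word = "('x \<times> bool) list"

definition words :: "'x set \<Rightarrow> 'x word set" where
  "words X = lists (X \<times> UNIV)"

definition word_inv :: "'x word \<Rightarrow> 'x word" where
  "word_inv w = rev (map (\<lambda>(x, b). (x, \<not> b)) w)"

definition word_monoid :: "'x set \<Rightarrow> 'x word monoid" where
  "word_monoid X = \<lparr>carrier = words X, mult = (@), one = []\<rparr>"

text \<open>The congruence on words generated by the defining relations \<open>R\<close> and by the relations
  $u u^{-1} u = u$ and $u u^{-1} v v^{-1} = v v^{-1} u u^{-1}$ that define the free inverse monoid.\<close>

inductive_set inv_cong :: "'x set \<Rightarrow> ('x word \<times> 'x word) set \<Rightarrow> ('x word \<times> 'x word) set"
  for X R where
  rel: "(u, v) \<in> R \<Longrightarrow> u \<in> words X \<Longrightarrow> v \<in> words X \<Longrightarrow> (u, v) \<in> inv_cong X R"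
| regular: "u \<in> words X \<Longrightarrow> (u @ word_inv u @ u, u) \<in> inv_cong X R"
| commute: "u \<in> words X \<Longrightarrow> v \<in> words X \<Longrightarrow>
    (u @ word_inv u @ v @ word_inv v, v @ word_inv v @ u @ word_inv u) \<in> inv_cong X R"
| refl: "u \<in> words X \<Longrightarrow> (u, u) \<in> inv_cong X R"
| sym: "(u, v) \<in> inv_cong X R \<Longrightarrow> (v, u) \<in> inv_cong X R"
| trans: "(u, v) \<in> inv_cong X R \<Longrightarrow> (v, w) \<in> inv_cong X R \<Longrightarrow> (u, w) \<in> inv_cong X R"
| mult: "(u, v) \<in> inv_cong X R \<Longrightarrow> (u', v') \<in> inv_cong X R \<Longrightarrow> (u @ u', v @ v') \<in> inv_cong X R"

definition Inv :: "'x set \<Rightarrow> ('x word \<times> 'x word) set \<Rightarrow> 'x word set monoid" where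
  "Inv X R = quot_monoid (word_monoid X) (inv_cong X R)"

text \<open>Generators are drawn from \<^typ>\<open>nat\<close>, which is no loss for a finite generating set.\<close>

definition has_finite_special_presentation :: "('a, 'm) monoid_scheme \<Rightarrow> bool" where
  "has_finite_special_presentation G \<longleftrightarrow>
     (\<exists>(X :: nat set) R. finite X \<and> finite R \<and> R \<subseteq> words X \<times> {[]} \<and> G \<cong> Inv X R)"

section \<open>Amalgamated free products\<close>

text \<open>Every inverse monoid is presented by its carrier subject to its multiplication table.
  Letters \<open>(a, False)\<close> need no relations of their own, since inverses are unique.\<close>

definition mult_table :: "('a, 'm) monoid_scheme \<Rightarrow> ('a \<Rightarrow> 'x) \<Rightarrow> ('x word \<times> 'x word) set" where
  "mult_table G j =
     insert ([(j \<one>\<^bsub>G\<^esub>, True)], [])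
       {([(j a, True), (j b, True)], [(j (a \<otimes>\<^bsub>G\<^esub> b), True)]) | a b. a \<in> carrier G \<and> b \<in> carrier G}"

text \<open>The free product of \<open>G\<close> and \<open>H\<close> amalgamating \<open>N\<close> along embeddings \<open>i\<close> and \<open>j\<close>, given by
  the presentation on the disjoint union of generators with both sets of relations and
  $i(n) = j(n)$ for all $n$. It is the pushout of inverse monoids; see \<open>amalgam_pushout\<close> below.\<close>

definition amalgam ::
  "('a, 'm) monoid_scheme \<Rightarrow> ('b, 'n) monoid_scheme \<Rightarrow> ('c, 'k) monoid_scheme \<Rightarrow>
   ('c \<Rightarrow> 'a) \<Rightarrow> ('c \<Rightarrow> 'b) \<Rightarrow> ('a + 'b) word set monoid" where
  "amalgam G H N i j =
     Inv (carrier G <+> carrier H)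
       (mult_table G Inl \<union> mult_table H Inr \<union>
        {([(Inl (i n), True)], [(Inr (j n), True)]) | n. n \<in> carrier N})"

section \<open>Basic facts about the definitions\<close>

context inverse_monoid
begin

lemma minv_props:
  assumes "x \<in> carrier G"
  shows "minv G x \<in> carrier G" "x \<otimes> minv G x \<otimes> x = x" "minv G x \<otimes> x \<otimes> minv G x = minv G x"
  using theI'[OF ex1_inverse[OF assms]] unfolding minv_def by auto

lemma minv_unique:
  assumes "x \<in> carrier G" "y \<in> carrier G" "x \<otimes> y \<otimes> x = x" "y \<otimes> x \<otimes> y = y"
  shows "minv G x = y"
  using ex1_inverse[OF assms(1)] minv_props[OF assms(1)] assms by blast

lemma inverses_eq:
  assumes "x \<in> carrier G" "y \<in> carrier G" "x \<otimes> y \<otimes> x = x" "y \<otimes> x \<otimes> y = y"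
    "z \<in> carrier G" "x \<otimes> z \<otimes> x = x" "z \<otimes> x \<otimes> z = z"
  shows "y = z"
  using minv_unique assms by metis

lemma idem_prod:
  assumes e: "e \<in> carrier G" "e \<otimes> e = e" and f: "f \<in> carrier G" "f \<otimes> f = f"
  shows "(e \<otimes> f) \<otimes> (e \<otimes> f) = e \<otimes> f"
proof -
  define x where "x = minv G (e \<otimes> f)"
  have ef: "e \<otimes> f \<in> carrier G" using e f by simp
  note x = minv_props[OF ef, folded x_def]
  have ee: "e \<otimes> (e \<otimes> z) = e \<otimes> z" if "z \<in> carrier G" for z
    using e that m_assoc by metis
  have ff: "f \<otimes> (f \<otimes> z) = f \<otimes> z" if "z \<in> carrier G" for z
    using f that m_assoc by metis
  have x2: "e \<otimes> (f \<otimes> (x \<otimes> (e \<otimes> f))) = e \<otimes> f"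
    using x e f by (simp add: m_assoc)
  have x3: "x \<otimes> (e \<otimes> (f \<otimes> x)) = x"
    using x e f by (simp add: m_assoc)
  have x3': "x \<otimes> (e \<otimes> (f \<otimes> (x \<otimes> z))) = x \<otimes> z" if "z \<in> carrier G" for z
  proof -
    have "x \<otimes> (e \<otimes> (f \<otimes> (x \<otimes> z))) = (x \<otimes> (e \<otimes> (f \<otimes> x))) \<otimes> z"
      using x(1) e f that by (simp add: m_assoc)
    then show ?thesis using x3 by simp
  qed
  have "x = f \<otimes> x \<otimes> e"
    unfolding x_def
    by (rule minv_unique[OF ef]; fold x_def; use x(1) e f ee ff x2 x3' in \<open>simp add: m_assoc\<close>)
  then have xx: "x \<otimes> x = x"
    using x(1) e f x3' by (metis (no_types, opaque_lifting) m_assoc m_closed)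
  have "e \<otimes> f = x"
    by (rule inverses_eq[of x]) (use x ef xx in simp_all)
  then show ?thesis using xx by simp
qed

lemma idem_commute:
  assumes e: "e \<in> carrier G" "e \<otimes> e = e" and f: "f \<in> carrier G" "f \<otimes> f = f"
  shows "e \<otimes> f = f \<otimes> e"
proof -
  have ee: "e \<otimes> (e \<otimes> z) = e \<otimes> z" if "z \<in> carrier G" for z
    using e that m_assoc by metis
  have ff: "f \<otimes> (f \<otimes> z) = f \<otimes> z" if "z \<in> carrier G" for z
    using f that m_assoc by metis
  have 1: "e \<otimes> (f \<otimes> (e \<otimes> f)) = e \<otimes> f"
    using idem_prod[OF e f] e f by (simp add: m_assoc)
  have 2: "f \<otimes> (e \<otimes> (f \<otimes> e)) = f \<otimes> e"
    using idem_prod[OF f e] e f by (simp add: m_assoc)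
  show ?thesis
    by (rule inverses_eq[of "e \<otimes> f"]) (use e f ee ff 1 2 in \<open>simp_all add: m_assoc\<close>)
qed

lemma minv_idem:
  assumes x: "x \<in> carrier G"
  shows "(x \<otimes> minv G x) \<otimes> (x \<otimes> minv G x) = x \<otimes> minv G x"
    "(minv G x \<otimes> x) \<otimes> (minv G x \<otimes> x) = minv G x \<otimes> x"
  using minv_props[OF x] x by (metis m_assoc m_closed)+

lemma minv_minv: "x \<in> carrier G \<Longrightarrow> minv G (minv G x) = x"
  by (rule minv_unique) (auto simp: minv_props)

lemma minv_one: "minv G \<one> = \<one>"
  by (rule minv_unique) auto

lemma minv_mult:
  assumes x: "x \<in> carrier G" and y: "y \<in> carrier G"
  shows "minv G (x \<otimes> y) = minv G y \<otimes> minv G x"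
proof (rule minv_unique)
  let ?x = "minv G x" and ?y = "minv G y"
  note c = x y minv_props(1)[OF x] minv_props(1)[OF y]
  have com: "(y \<otimes> ?y) \<otimes> (?x \<otimes> x) = (?x \<otimes> x) \<otimes> (y \<otimes> ?y)"
    by (rule idem_commute) (use c minv_idem in simp_all)
  have "x \<otimes> y \<otimes> (?y \<otimes> ?x) \<otimes> (x \<otimes> y) = x \<otimes> ((y \<otimes> ?y) \<otimes> (?x \<otimes> x)) \<otimes> y"
    using c by (simp add: m_assoc)
  also have "\<dots> = (x \<otimes> ?x \<otimes> x) \<otimes> (y \<otimes> ?y \<otimes> y)"
    unfolding com using c by (simp add: m_assoc)
  finally show "x \<otimes> y \<otimes> (?y \<otimes> ?x) \<otimes> (x \<otimes> y) = x \<otimes> y"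
    using minv_props x y by simp
  have "?y \<otimes> ?x \<otimes> (x \<otimes> y) \<otimes> (?y \<otimes> ?x) = ?y \<otimes> ((?x \<otimes> x) \<otimes> (y \<otimes> ?y)) \<otimes> ?x"
    using c by (simp add: m_assoc)
  also have "\<dots> = (?y \<otimes> y \<otimes> ?y) \<otimes> (?x \<otimes> x \<otimes> ?x)"
    unfolding com[symmetric] using c by (simp add: m_assoc)
  finally show "?y \<otimes> ?x \<otimes> (x \<otimes> y) \<otimes> (?y \<otimes> ?x) = ?y \<otimes> ?x"
    using minv_props x y by simp
qed (use x y minv_props in auto)

end

lemma mon_homI:
  assumes "\<And>x. x \<in> carrier G \<Longrightarrow> h x \<in> carrier H"
    "\<And>x y. x \<in> carrier G \<Longrightarrow> y \<in> carrier G \<Longrightarrow> h (x \<otimes>\<^bsub>G\<^esub> y) = h x \<otimes>\<^bsub>H\<^esub> h y"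
    "h \<one>\<^bsub>G\<^esub> = \<one>\<^bsub>H\<^esub>"
  shows "h \<in> mon_hom G H"
  using assms by (auto simp: mon_hom_def hom_def)

lemma mon_homD:
  assumes "h \<in> mon_hom G H"
  shows "x \<in> carrier G \<Longrightarrow> h x \<in> carrier H"
    "x \<in> carrier G \<Longrightarrow> y \<in> carrier G \<Longrightarrow> h (x \<otimes>\<^bsub>G\<^esub> y) = h x \<otimes>\<^bsub>H\<^esub> h y"
    "h \<one>\<^bsub>G\<^esub> = \<one>\<^bsub>H\<^esub>"
  using assms by (auto simp: mon_hom_def hom_def)

lemma mon_hom_minv:
  assumes G: "inverse_monoid G" and H: "inverse_monoid H" and h: "h \<in> mon_hom G H"
    and x: "x \<in> carrier G"
  shows "h (minv G x) = minv H (h x)"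
proof -
  interpret G: inverse_monoid G by fact
  interpret H: inverse_monoid H by fact
  note p = G.minv_props[OF x]
  show ?thesis
    by (rule H.minv_unique[symmetric])
      (use p x mon_homD[OF h] in \<open>metis G.m_closed\<close>)+
qed

lemma quot_mult:
  assumes r: "mon_congruence G r" and a: "a \<in> carrier G" and b: "b \<in> carrier G"
  shows "r `` {a} \<otimes>\<^bsub>quot_monoid G r\<^esub> r `` {b} = r `` {a \<otimes>\<^bsub>G\<^esub> b}"
proof -
  have eq: "equiv (carrier G) r"
    and m: "\<And>a b c d. (a, b) \<in> r \<Longrightarrow> (c, d) \<in> r \<Longrightarrow> (a \<otimes>\<^bsub>G\<^esub> c, b \<otimes>\<^bsub>G\<^esub> d) \<in> r"
    using r unfolding mon_congruence_def by blast+
  have "(\<Union>a'\<in>r `` {a}. \<Union>b'\<in>r `` {b}. r `` {a' \<otimes>\<^bsub>G\<^esub> b'}) =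
      (\<Union>a'\<in>r `` {a}. \<Union>b'\<in>r `` {b}. r `` {a \<otimes>\<^bsub>G\<^esub> b})"
  proof (intro SUP_cong)
    show "r `` {a' \<otimes>\<^bsub>G\<^esub> b'} = r `` {a \<otimes>\<^bsub>G\<^esub> b}" if "a' \<in> r `` {a}" "b' \<in> r `` {b}" for a' b'
      using equiv_class_eq[OF eq m[of a a' b b']] that by simp
  qed simp_all
  moreover have "a \<in> r `` {a}" "b \<in> r `` {b}"
    using equiv_class_self[OF eq] a b by auto
  then have "(\<Union>a'\<in>r `` {a}. \<Union>b'\<in>r `` {b}. r `` {a \<otimes>\<^bsub>G\<^esub> b}) = r `` {a \<otimes>\<^bsub>G\<^esub> b}"
    by blast
  ultimately show ?thesis unfolding quot_monoid_def by simp
qed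

lemma quot_monoid_is_monoid:
  fixes G (structure)
  assumes G: "monoid G" and r: "mon_congruence G r"
  shows "monoid (quot_monoid G r)"
proof -
  interpret monoid G by fact
  have c: "carrier (quot_monoid G r) = carrier G // r" and o: "\<one>\<^bsub>quot_monoid G r\<^esub> = r `` {\<one>}"
    by (simp_all add: quot_monoid_def)
  show ?thesis
    by (rule monoidI) (auto simp: c o quot_mult[OF r] m_assoc elim!: quotientE intro!: quotientI)
qed

lemma group_quot_iff:
  fixes G (structure)
  assumes G: "monoid G" and r: "mon_congruence G r"
  shows "group (quot_monoid G r) \<longleftrightarrow> (\<forall>x\<in>carrier G. \<exists>y\<in>carrier G. (y \<otimes>\<^bsub>G\<^esub> x, \<one>\<^bsub>G\<^esub>) \<in> r)"
proof -
  interpret monoid G by fact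
  interpret Q: monoid "quot_monoid G r" by (rule quot_monoid_is_monoid[OF assms])
  have eq: "equiv (carrier G) r" using r unfolding mon_congruence_def by blast
  have c: "carrier (quot_monoid G r) = carrier G // r" and o: "\<one>\<^bsub>quot_monoid G r\<^esub> = r `` {\<one>}"
    by (simp_all add: quot_monoid_def)
  have *: "r `` {y} \<otimes>\<^bsub>quot_monoid G r\<^esub> r `` {x} = \<one>\<^bsub>quot_monoid G r\<^esub> \<longleftrightarrow> (y \<otimes> x, \<one>) \<in> r"
    if "x \<in> carrier G" "y \<in> carrier G" for x y
    using that eq_equiv_class_iff[OF eq, of "y \<otimes> x" \<one>] by (simp add: quot_mult[OF r] o)
  show ?thesis
  proof
    assume "group (quot_monoid G r)"
    then interpret Q: group "quot_monoid G r" .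
    show "\<forall>x\<in>carrier G. \<exists>y\<in>carrier G. (y \<otimes> x, \<one>) \<in> r"
    proof
      fix x assume x: "x \<in> carrier G"
      then have "r `` {x} \<in> carrier (quot_monoid G r)" by (simp add: c quotientI)
      then obtain A where "A \<in> carrier G // r" "A \<otimes>\<^bsub>quot_monoid G r\<^esub> r `` {x} = \<one>\<^bsub>quot_monoid G r\<^esub>"
        using Q.l_inv_ex c by blast
      then show "\<exists>y\<in>carrier G. (y \<otimes> x, \<one>) \<in> r"
        using * x by (auto elim!: quotientE)
    qed
  next
    assume h: "\<forall>x\<in>carrier G. \<exists>y\<in>carrier G. (y \<otimes> x, \<one>) \<in> r"
    show "group (quot_monoid G r)"
    proof (rule groupI)
      fix A assume "A \<in> carrier (quot_monoid G r)"
      then obtain x where x: "x \<in> carrier G" "A = r `` {x}" by (auto simp: c elim: quotientE)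
      with h obtain y where "y \<in> carrier G" "(y \<otimes> x, \<one>) \<in> r" by blast
      then show "\<exists>B\<in>carrier (quot_monoid G r). B \<otimes>\<^bsub>quot_monoid G r\<^esub> A = \<one>\<^bsub>quot_monoid G r\<^esub>"
        using * x c quotientI by metis
    qed (auto simp: Q.m_assoc)
  qed
qed

lemma (in inverse_monoid) min_group_cong_least:
  shows "group_congruence G (min_group_cong G)"
    and "group_congruence G r \<Longrightarrow> min_group_cong G \<subseteq> r"
proof -
  show "group_congruence G r \<Longrightarrow> min_group_cong G \<subseteq> r" for r
    unfolding min_group_cong_def by auto
  let ?U = "carrier G \<times> carrier G"
  have U: "mon_congruence G ?U"
    by (auto simp: mon_congruence_def equiv_def refl_on_def sym_def trans_def)
  have gU: "group_congruence G ?U"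
    unfolding group_congruence_def using U group_quot_iff[OF monoid_axioms U] by auto
  have cong: "mon_congruence G (min_group_cong G)"
  proof -
    have iff: "(a, b) \<in> min_group_cong G \<longleftrightarrow> (\<forall>r. group_congruence G r \<longrightarrow> (a, b) \<in> r)" for a b
      by (auto simp: min_group_cong_def)
    have r: "equiv (carrier G) r"
      "(a, b) \<in> r \<Longrightarrow> (c, d) \<in> r \<Longrightarrow> (a \<otimes> c, b \<otimes> d) \<in> r"
      if "group_congruence G r" for r a b c d
      using that unfolding group_congruence_def mon_congruence_def by blast+
    have "equiv (carrier G) (min_group_cong G)"
    proof (rule equivI)
      show "min_group_cong G \<subseteq> ?U" using gU unfolding min_group_cong_def by blast
      show "refl_on (carrier G) (min_group_cong G)"
        using r(1) by (meson equivE iff refl_on_def)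
      show "sym (min_group_cong G)"
        using r(1) by (meson equivE iff symD symI)
      show "trans (min_group_cong G)"
        using r(1) by (meson equivE iff transD transI)
    qed
    then show ?thesis unfolding mon_congruence_def using iff r(2) by blast
  qed
  have "(minv G x \<otimes> x, \<one>) \<in> min_group_cong G" if x: "x \<in> carrier G" for x
    unfolding min_group_cong_def
  proof safe
    fix r assume r: "group_congruence G r"
    let ?Q = "quot_monoid G r" and ?e = "minv G x \<otimes> x"
    have rc: "mon_congruence G r" and eq: "equiv (carrier G) r" and "group ?Q"
      using r by (auto simp: group_congruence_def mon_congruence_def)
    then interpret Q: group ?Q by simp
    have e: "?e \<in> carrier G" "?e \<otimes> ?e = ?e" using x minv_props minv_idem by auto
    have "r `` {?e} \<in> carrier ?Q" using e by (simp add: quot_monoid_def quotientI)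
    moreover have "r `` {?e} \<otimes>\<^bsub>?Q\<^esub> r `` {?e} = r `` {?e}" using quot_mult[OF rc e(1) e(1)] e by simp
    ultimately have "r `` {?e} = \<one>\<^bsub>?Q\<^esub>" by simp
    then have "r `` {?e} = r `` {\<one>}" by (simp add: quot_monoid_def)
    then show "(?e, \<one>) \<in> r" using eq_equiv_class_iff[OF eq] e by simp
  qed
  then show "group_congruence G (min_group_cong G)"
    unfolding group_congruence_def using cong group_quot_iff[OF monoid_axioms cong] minv_props by blast
qed

lemma word_inv_simps [simp]:
  "word_inv [] = []" "word_inv (u @ v) = word_inv v @ word_inv u" "word_inv (word_inv u) = u"
  "word_inv [(x, b)] = [(x, \<not> b)]" "word_inv u \<in> words X \<longleftrightarrow> u \<in> words X"
  by (force simp: word_inv_def words_def rev_map comp_def split_def)+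

lemma words_simps [simp]:
  "[] \<in> words X" "p # u \<in> words X \<longleftrightarrow> fst p \<in> X \<and> u \<in> words X"
  "u @ v \<in> words X \<longleftrightarrow> u \<in> words X \<and> v \<in> words X"
  by (cases p; auto simp: words_def)+

lemma inv_cong_words: "(u, v) \<in> inv_cong X R \<Longrightarrow> u \<in> words X \<and> v \<in> words X"
  by (induction rule: inv_cong.induct) auto

lemma word_monoid_is_monoid: "monoid (word_monoid X)"
  by (rule monoidI) (auto simp: word_monoid_def)

lemma inv_cong_congruence: "mon_congruence (word_monoid X) (inv_cong X R)"
proof -
  have "equiv (words X) (inv_cong X R)"
  proof (rule equivI)
    show "inv_cong X R \<subseteq> words X \<times> words X" by (auto dest: inv_cong_words)
  qed (auto simp: refl_on_def sym_def trans_def intro: inv_cong.refl inv_cong.sym inv_cong.trans)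
  then show ?thesis
    unfolding mon_congruence_def using inv_cong.mult by (auto simp: word_monoid_def)
qed

lemma Inv_carrier: "carrier (Inv X R) = words X // inv_cong X R"
  and Inv_one: "\<one>\<^bsub>Inv X R\<^esub> = inv_cong X R `` {[]}"
  by (simp_all add: Inv_def quot_monoid_def word_monoid_def)

lemma Inv_mult:
  "u \<in> words X \<Longrightarrow> v \<in> words X \<Longrightarrow>
    inv_cong X R `` {u} \<otimes>\<^bsub>Inv X R\<^esub> inv_cong X R `` {v} = inv_cong X R `` {u @ v}"
  using quot_mult[OF inv_cong_congruence, of u X v R] by (simp add: Inv_def word_monoid_def)

lemma Inv_eq_iff:
  "u \<in> words X \<Longrightarrow> v \<in> words X \<Longrightarrow>
    inv_cong X R `` {u} = inv_cong X R `` {v} \<longleftrightarrow> (u, v) \<in> inv_cong X R"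
  using inv_cong_congruence[of X R] eq_equiv_class_iff[of "words X" "inv_cong X R" u v]
  by (simp add: mon_congruence_def word_monoid_def)

text \<open>A regular monoid in which a choice of inverses gives commuting idempotents is inverse.\<close>

lemma inverse_monoidI_commuting:
  fixes G (structure)
  assumes "monoid G"
    and i: "\<And>x. x \<in> carrier G \<Longrightarrow> i x \<in> carrier G" "\<And>x. x \<in> carrier G \<Longrightarrow> i (i x) = x"
      "\<And>x. x \<in> carrier G \<Longrightarrow> x \<otimes> i x \<otimes> x = x"
      "\<And>x y. x \<in> carrier G \<Longrightarrow> y \<in> carrier G \<Longrightarrow>
         (x \<otimes> i x) \<otimes> (y \<otimes> i y) = (y \<otimes> i y) \<otimes> (x \<otimes> i x)"
  shows "inverse_monoid G"
proof -
  interpret monoid G by fact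
  have i3: "i x \<otimes> x \<otimes> i x = i x" if "x \<in> carrier G" for x
    using i(3)[of "i x"] i(1,2) that by simp
  have form: "e = e \<otimes> i e" if e: "e \<in> carrier G" "e \<otimes> e = e" for e
  proof -
    have ie: "i e \<in> carrier G" using i e by simp
    have com: "(e \<otimes> i e) \<otimes> (i e \<otimes> e) = (i e \<otimes> e) \<otimes> (e \<otimes> i e)"
      using i(4)[of e "i e"] i(2) e ie by simp
    have "i e = i e \<otimes> (e \<otimes> e) \<otimes> i e" using i3 e by simp
    also have "\<dots> = (i e \<otimes> e) \<otimes> (e \<otimes> i e)" using e(1) ie by (simp only: m_assoc m_closed)
    finally have q: "i e = (e \<otimes> i e) \<otimes> (i e \<otimes> e)" using com by simp
    have ee: "e \<otimes> (e \<otimes> z) = e \<otimes> z" if "z \<in> carrier G" for z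
      using e that m_assoc by metis
    have "e = e \<otimes> i e \<otimes> e" using i(3) e by simp
    also have "\<dots> = e \<otimes> ((e \<otimes> i e) \<otimes> (i e \<otimes> e)) \<otimes> e" using q by simp
    also have "\<dots> = (e \<otimes> i e) \<otimes> (i e \<otimes> e)" using e ie ee by (simp add: m_assoc)
    finally have "e = i e" using q by simp
    then show ?thesis using e by simp
  qed
  have comm: "e \<otimes> f = f \<otimes> e"
    if "e \<in> carrier G" "e \<otimes> e = e" "f \<in> carrier G" "f \<otimes> f = f" for e f
    using form that i(4)[of e f] by metis
  have uniq: "y = z"
    if c: "x \<in> carrier G" "y \<in> carrier G" "z \<in> carrier G"
      and y: "x \<otimes> y \<otimes> x = x" "y \<otimes> x \<otimes> y = y" and z: "x \<otimes> z \<otimes> x = x" "z \<otimes> x \<otimes> z = z" for x y z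
  proof -
    have id: "(x \<otimes> y) \<otimes> (x \<otimes> y) = x \<otimes> y" "(y \<otimes> x) \<otimes> (y \<otimes> x) = y \<otimes> x"
      "(x \<otimes> z) \<otimes> (x \<otimes> z) = x \<otimes> z" "(z \<otimes> x) \<otimes> (z \<otimes> x) = z \<otimes> x"
      using c y z by (metis m_assoc m_closed)+
    have "y = y \<otimes> (x \<otimes> z \<otimes> x) \<otimes> y" using y z by simp
    also have "\<dots> = ((y \<otimes> x) \<otimes> (z \<otimes> x)) \<otimes> y" using c by (simp add: m_assoc)
    also have "\<dots> = ((z \<otimes> x) \<otimes> (y \<otimes> x)) \<otimes> y" using comm c id by simp
    also have "\<dots> = z \<otimes> (x \<otimes> y \<otimes> x) \<otimes> y" using c by (simp add: m_assoc)
    also have "\<dots> = z \<otimes> (x \<otimes> y)" using c y by (simp add: m_assoc)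
    finally have 1: "y = z \<otimes> (x \<otimes> y)" .
    have "z = z \<otimes> (x \<otimes> y \<otimes> x) \<otimes> z" using y z by simp
    also have "\<dots> = z \<otimes> ((x \<otimes> y) \<otimes> (x \<otimes> z))" using c by (simp add: m_assoc)
    also have "\<dots> = z \<otimes> ((x \<otimes> z) \<otimes> (x \<otimes> y))" using comm[of "x \<otimes> y" "x \<otimes> z"] c id by simp
    also have "\<dots> = (z \<otimes> x \<otimes> z) \<otimes> (x \<otimes> y)" using c by (simp add: m_assoc)
    finally show ?thesis using 1 z by simp
  qed
  show ?thesis
  proof (unfold_locales, rule ex_ex1I)
    fix x assume "x \<in> carrier G"
    then show "\<exists>y. y \<in> carrier G \<and> x \<otimes> y \<otimes> x = x \<and> y \<otimes> x \<otimes> y = y"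
      using i(1,3) i3 by blast
  qed (use uniq in blast)
qed

lemma inv_cong_word_inv:
  assumes R: "(u, v) \<in> inv_cong X R"
  shows "(word_inv u, word_inv v) \<in> inv_cong X R"
proof -
  let ?r = "inv_cong X R"
  have w: "u \<in> words X" "v \<in> words X" using inv_cong_words[OF R] by auto
  let ?u = "word_inv u" and ?v = "word_inv v"
  note [trans] = inv_cong.trans
  have r: "(a, a) \<in> ?r" if "a \<in> words X" for a using that by (rule inv_cong.refl)
  have ctx: "(a @ p @ b, a @ q @ b) \<in> ?r" if "(p, q) \<in> ?r" "a \<in> words X" "b \<in> words X" for a b p q
    using that by (intro inv_cong.mult r) auto
  have R': "(v, u) \<in> ?r" using R by (rule inv_cong.sym)
  have reg: "(a, a @ word_inv a @ a) \<in> ?r" if "a \<in> words X" for a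
    using inv_cong.sym[OF inv_cong.regular[OF that]] .
  have half: "(word_inv a, word_inv a @ a @ word_inv b) \<in> ?r"
    if ab: "(a, b) \<in> ?r" "(b, a) \<in> ?r" and wa: "a \<in> words X" "b \<in> words X" for a b
  proof -
    let ?a = "word_inv a" and ?b = "word_inv b"
    have "(?a, ?a @ a @ ?a) \<in> ?r" using reg[of ?a] wa by simp
    also have "(?a @ a @ ?a, ?a @ b @ ?a) \<in> ?r" using ctx[OF ab(1), of ?a ?a] wa by simp
    also have "(?a @ b @ ?a, ?a @ (b @ ?b @ b) @ ?a) \<in> ?r"
      using ctx[OF reg[of b], of ?a ?a] wa by simp
    also have "(?a @ (b @ ?b @ b) @ ?a, ?a @ (b @ ?b) @ a @ ?a) \<in> ?r"
      using ctx[OF ab(2), of "?a @ b @ ?b" ?a] wa by simp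
    also have "(?a @ (b @ ?b) @ a @ ?a, ?a @ a @ ?a @ b @ ?b) \<in> ?r"
      using ctx[OF inv_cong.commute[of b X a], of ?a "[]"] wa by simp
    also have "(?a @ a @ ?a @ b @ ?b, ?a @ b @ ?b) \<in> ?r"
      using ctx[OF inv_cong.regular[of ?a], of "[]" "b @ ?b"] wa by simp
    also have "(?a @ b @ ?b, ?a @ a @ ?b) \<in> ?r"
      using ctx[OF ab(2), of ?a ?b] wa by simp
    finally show ?thesis .
  qed
  have half': "(word_inv b, word_inv a @ a @ word_inv b) \<in> ?r"
    if ab: "(a, b) \<in> ?r" "(b, a) \<in> ?r" and wa: "a \<in> words X" "b \<in> words X" for a b
  proof -
    let ?a = "word_inv a" and ?b = "word_inv b"
    have "(?b, ?b @ b @ ?b) \<in> ?r" using reg[of ?b] wa by simp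
    also have "(?b @ b @ ?b, ?b @ a @ ?b) \<in> ?r" using ctx[OF ab(2), of ?b ?b] wa by simp
    also have "(?b @ a @ ?b, ?b @ (a @ ?a @ a) @ ?b) \<in> ?r"
      using ctx[OF reg[of a], of ?b ?b] wa by simp
    also have "(?b @ (a @ ?a @ a) @ ?b, ?b @ b @ ?a @ a @ ?b) \<in> ?r"
      using ctx[OF ab(1), of ?b "?a @ a @ ?b"] wa by simp
    also have "(?b @ b @ ?a @ a @ ?b, ?a @ a @ ?b @ b @ ?b) \<in> ?r"
      using ctx[OF inv_cong.commute[of ?b X ?a], of "[]" "?b"] wa by simp
    also have "(?a @ a @ ?b @ b @ ?b, ?a @ a @ ?b) \<in> ?r"
      using ctx[OF inv_cong.regular[of ?b], of "?a @ a" "[]"] wa by simp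
    finally show ?thesis .
  qed
  show ?thesis
    using half[OF R R' w] inv_cong.sym[OF half'[OF R R' w]] by (rule inv_cong.trans)
qed

theorem Inv_inverse_monoid: "inverse_monoid (Inv X R)"
proof -
  let ?r = "inv_cong X R"
  have m: "monoid (Inv X R)"
    unfolding Inv_def by (rule quot_monoid_is_monoid[OF word_monoid_is_monoid inv_cong_congruence])
  have self: "u \<in> ?r `` {u}" if "u \<in> words X" for u
    using that by (auto intro: inv_cong.refl)
  define i where "i A = ?r `` {word_inv (SOME w. w \<in> A)}" for A
  have i: "i (?r `` {u}) = ?r `` {word_inv u}" if u: "u \<in> words X" for u
  proof -
    have "(SOME w. w \<in> ?r `` {u}) \<in> ?r `` {u}" using self[OF u] by (rule someI)
    then have "(u, SOME w. w \<in> ?r `` {u}) \<in> ?r" by simp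
    from inv_cong_word_inv[OF this] show ?thesis
      unfolding i_def using Inv_eq_iff inv_cong_words by (metis inv_cong.sym)
  qed
  show ?thesis
  proof (rule inverse_monoidI_commuting[OF m, of i])
    fix A assume "A \<in> carrier (Inv X R)"
    then obtain u where u: "u \<in> words X" "A = ?r `` {u}" by (auto simp: Inv_carrier elim: quotientE)
    show "i A \<in> carrier (Inv X R)" "i (i A) = A"
      using u by (simp_all add: i Inv_carrier quotientI)
    show "A \<otimes>\<^bsub>Inv X R\<^esub> i A \<otimes>\<^bsub>Inv X R\<^esub> A = A"
      using u inv_cong.regular[of u X R] by (simp add: i Inv_mult Inv_eq_iff)
    fix B assume "B \<in> carrier (Inv X R)"
    then obtain v where v: "v \<in> words X" "B = ?r `` {v}" by (auto simp: Inv_carrier elim: quotientE)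
    show "(A \<otimes>\<^bsub>Inv X R\<^esub> i A) \<otimes>\<^bsub>Inv X R\<^esub> (B \<otimes>\<^bsub>Inv X R\<^esub> i B) =
        (B \<otimes>\<^bsub>Inv X R\<^esub> i B) \<otimes>\<^bsub>Inv X R\<^esub> (A \<otimes>\<^bsub>Inv X R\<^esub> i A)"
      using u v inv_cong.commute[of u X v R] by (simp add: i Inv_mult Inv_eq_iff)
  qed
qed

primrec word_eval :: "('a, 'm) monoid_scheme \<Rightarrow> ('x \<Rightarrow> 'a) \<Rightarrow> 'x word \<Rightarrow> 'a" where
  "word_eval G f [] = \<one>\<^bsub>G\<^esub>"
| "word_eval G f (p # w) =
     (if snd p then f (fst p) else minv G (f (fst p))) \<otimes>\<^bsub>G\<^esub> word_eval G f w"

context inverse_monoid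
begin

lemma word_eval_closed: "f ` X \<subseteq> carrier G \<Longrightarrow> w \<in> words X \<Longrightarrow> word_eval G f w \<in> carrier G"
  by (induction w) (auto simp: minv_props image_subset_iff)

lemma word_eval_append:
  "f ` X \<subseteq> carrier G \<Longrightarrow> u \<in> words X \<Longrightarrow> v \<in> words X \<Longrightarrow>
    word_eval G f (u @ v) = word_eval G f u \<otimes> word_eval G f v"
  by (induction u) (auto simp: minv_props image_subset_iff word_eval_closed m_assoc)

lemma word_eval_inv:
  assumes f: "f ` X \<subseteq> carrier G"
  shows "w \<in> words X \<Longrightarrow> word_eval G f (word_inv w) = minv G (word_eval G f w)"
proof (induction w)
  case (Cons p w)
  obtain x b where p: "p = (x, b)" by (cases p)
  have c: "x \<in> X" "f x \<in> carrier G" "w \<in> words X" "word_eval G f w \<in> carrier G"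
    using Cons p f word_eval_closed[OF f] by auto
  have "word_inv (p # w) = word_inv w @ [(x, \<not> b)]"
    using word_inv_simps(2)[of "[p]" w] p by simp
  then have "word_eval G f (word_inv (p # w)) =
      word_eval G f (word_inv w) \<otimes> word_eval G f [(x, \<not> b)]"
    using word_eval_append[OF f, of "word_inv w" "[(x, \<not> b)]"] c by simp
  then show ?case
    using Cons c p by (auto simp: minv_mult minv_minv minv_props)
qed (simp add: minv_one)

lemma word_eval_inv_cong:
  assumes f: "f ` X \<subseteq> carrier G"
    and R: "\<And>u v. (u, v) \<in> R \<Longrightarrow> word_eval G f u = word_eval G f v"
  shows "(u, v) \<in> inv_cong X R \<Longrightarrow> word_eval G f u = word_eval G f v"
proof (induction rule: inv_cong.induct)
  case (regular u)
  note c = word_eval_closed[OF f regular]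
  then show ?case using regular
    by (simp add: word_eval_append[OF f] word_eval_inv[OF f] minv_props flip: m_assoc)
next
  case (commute u v)
  let ?u = "word_eval G f u" and ?v = "word_eval G f v"
  have c: "?u \<in> carrier G" "?v \<in> carrier G" using commute word_eval_closed[OF f] by auto
  have "(?u \<otimes> minv G ?u) \<otimes> (?v \<otimes> minv G ?v) = (?v \<otimes> minv G ?v) \<otimes> (?u \<otimes> minv G ?u)"
    by (rule idem_commute) (use c minv_props minv_idem in auto)
  then show ?case using commute c
    by (simp add: word_eval_append[OF f] word_eval_inv[OF f] minv_props m_assoc)
next
  case (mult u v u' v')
  then show ?case using inv_cong_words word_eval_append[OF f] by metis
qed (use R in auto)

end

lemma Inv_universal:
  assumes T: "inverse_monoid T" and f: "f ` X \<subseteq> carrier T"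
    and R: "\<And>u v. (u, v) \<in> R \<Longrightarrow> word_eval T f u = word_eval T f v"
  shows "\<exists>h \<in> mon_hom (Inv X R) T. \<forall>x\<in>X. h (inv_cong X R `` {[(x, True)]}) = f x"
proof -
  interpret T: inverse_monoid T by fact
  let ?r = "inv_cong X R"
  define h where "h A = word_eval T f (SOME w. w \<in> A)" for A
  have h: "h (?r `` {u}) = word_eval T f u" if u: "u \<in> words X" for u
  proof -
    have "u \<in> ?r `` {u}" using u by (auto intro: inv_cong.refl)
    then have "(SOME w. w \<in> ?r `` {u}) \<in> ?r `` {u}" by (rule someI)
    then show ?thesis unfolding h_def using T.word_eval_inv_cong[OF f R] by (metis Image_singleton_iff)
  qed
  have "h \<in> mon_hom (Inv X R) T"
    by (auto simp: mon_hom_def hom_def Inv_carrier Inv_one h Inv_mult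
        T.word_eval_append[OF f] T.word_eval_closed[OF f] elim!: quotientE)
  then show ?thesis using f by (intro bexI[of _ h]) (auto simp: h image_subset_iff)
qed

lemma Inv_hom_unique:
  assumes T: "inverse_monoid T" and g: "g \<in> mon_hom (Inv X R) T" and h: "h \<in> mon_hom (Inv X R) T"
    and eq: "\<And>x. x \<in> X \<Longrightarrow> g (inv_cong X R `` {[(x, True)]}) = h (inv_cong X R `` {[(x, True)]})"
    and A: "A \<in> carrier (Inv X R)"
  shows "g A = h A"
proof -
  interpret I: inverse_monoid "Inv X R" by (rule Inv_inverse_monoid)
  interpret T: inverse_monoid T by fact
  let ?r = "inv_cong X R"
  have mem: "?r `` {u} \<in> carrier (Inv X R)" if "u \<in> words X" for u
    using that by (simp add: Inv_carrier quotientI)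
  have neg: "?r `` {[(x, False)]} = minv (Inv X R) (?r `` {[(x, True)]})" if "x \<in> X" for x
  proof (rule I.minv_unique[symmetric])
    show "?r `` {[(x, True)]} \<otimes>\<^bsub>Inv X R\<^esub> ?r `` {[(x, False)]} \<otimes>\<^bsub>Inv X R\<^esub> ?r `` {[(x, True)]} =
        ?r `` {[(x, True)]}"
      using that inv_cong.regular[of "[(x, True)]" X R] by (simp add: Inv_mult Inv_eq_iff)
    show "?r `` {[(x, False)]} \<otimes>\<^bsub>Inv X R\<^esub> ?r `` {[(x, True)]} \<otimes>\<^bsub>Inv X R\<^esub> ?r `` {[(x, False)]} =
        ?r `` {[(x, False)]}"
      using that inv_cong.regular[of "[(x, False)]" X R] by (simp add: Inv_mult Inv_eq_iff)
  qed (use that mem in auto)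
  have "g (?r `` {w}) = h (?r `` {w})" if "w \<in> words X" for w
    using that
  proof (induction w)
    case Nil
    then show ?case using mon_homD(3)[OF g] mon_homD(3)[OF h] by (simp add: Inv_one)
  next
    case (Cons p w)
    obtain x b where p: "p = (x, b)" by (cases p)
    have c: "x \<in> X" "w \<in> words X" using Cons p by auto
    have "g (?r `` {[p]}) = h (?r `` {[p]})"
      using eq[OF c(1)] neg[OF c(1)] p mem[of "[(x, True)]"] c
        mon_hom_minv[OF I.inverse_monoid_axioms T g] mon_hom_minv[OF I.inverse_monoid_axioms T h]
      by (cases b) simp_all
    moreover have "?r `` {p # w} = ?r `` {[p]} \<otimes>\<^bsub>Inv X R\<^esub> ?r `` {w}"
      using Inv_mult[of "[p]" X w R] p c by simp
    ultimately show ?case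
      using mon_homD(2)[OF g] mon_homD(2)[OF h] mem[of "[p]"] mem[of w] c p Cons.IH by simp
  qed
  then show ?thesis using A by (auto simp: Inv_carrier elim!: quotientE)
qed

definition amalgam_gen ::
  "('a, 'm) monoid_scheme \<Rightarrow> ('b, 'n) monoid_scheme \<Rightarrow> ('c, 'k) monoid_scheme \<Rightarrow>
   ('c \<Rightarrow> 'a) \<Rightarrow> ('c \<Rightarrow> 'b) \<Rightarrow> 'a + 'b \<Rightarrow> ('a + 'b) word set" where
  "amalgam_gen G H N i j x =
     inv_cong (carrier G <+> carrier H)
       (mult_table G Inl \<union> mult_table H Inr \<union>
        {([(Inl (i n), True)], [(Inr (j n), True)]) | n. n \<in> carrier N}) `` {[(x, True)]}"

theorem amalgam_pushout:
  fixes G :: "('a, 'm) monoid_scheme" and H :: "('b, 'n) monoid_scheme"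
    and N :: "('c, 'k) monoid_scheme"
  assumes G: "inverse_monoid G" and H: "inverse_monoid H"
    and i: "i \<in> mon_hom N G" and j: "j \<in> mon_hom N H"
  defines "\<alpha> \<equiv> \<lambda>a. amalgam_gen G H N i j (Inl a)" and "\<beta> \<equiv> \<lambda>b. amalgam_gen G H N i j (Inr b)"
  shows "inverse_monoid (amalgam G H N i j)"
    and "\<alpha> \<in> mon_hom G (amalgam G H N i j)" and "\<beta> \<in> mon_hom H (amalgam G H N i j)"
    and "\<And>n. n \<in> carrier N \<Longrightarrow> \<alpha> (i n) = \<beta> (j n)"
    and "\<And>(T :: ('t, 'l) monoid_scheme) p q.
      inverse_monoid T \<Longrightarrow> p \<in> mon_hom G T \<Longrightarrow> q \<in> mon_hom H T \<Longrightarrow>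
      (\<And>n. n \<in> carrier N \<Longrightarrow> p (i n) = q (j n)) \<Longrightarrow>
      \<exists>h \<in> mon_hom (amalgam G H N i j) T.
        (\<forall>a\<in>carrier G. h (\<alpha> a) = p a) \<and> (\<forall>b\<in>carrier H. h (\<beta> b) = q b) \<and>
        (\<forall>h' \<in> mon_hom (amalgam G H N i j) T.
          (\<forall>a\<in>carrier G. h' (\<alpha> a) = p a) \<and> (\<forall>b\<in>carrier H. h' (\<beta> b) = q b) \<longrightarrow>
          (\<forall>x\<in>carrier (amalgam G H N i j). h' x = h x))"
proof -
  interpret G: inverse_monoid G by fact
  interpret H: inverse_monoid H by fact
  define X where "X = carrier G <+> carrier H"
  define R where "R = mult_table G Inl \<union> mult_table H Inr \<union>
        {([(Inl (i n), True)], [(Inr (j n), True)]) | n. n \<in> carrier N}"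
  have M: "amalgam G H N i j = Inv X R" by (simp add: amalgam_def X_def R_def)
  have \<alpha>: "\<alpha> a = inv_cong X R `` {[(Inl a, True)]}" for a
    by (simp add: \<alpha>_def amalgam_gen_def X_def R_def)
  have \<beta>: "\<beta> b = inv_cong X R `` {[(Inr b, True)]}" for b
    by (simp add: \<beta>_def amalgam_gen_def X_def R_def)
  have X [simp]: "Inl a \<in> X \<longleftrightarrow> a \<in> carrier G" "Inr b \<in> X \<longleftrightarrow> b \<in> carrier H" for a b
    by (auto simp: X_def)
  have eqI: "inv_cong X R `` {u} = inv_cong X R `` {v}"
    if "(u, v) \<in> R" "u \<in> words X" "v \<in> words X" for u v
    using that by (simp add: Inv_eq_iff inv_cong.rel)
  show "inverse_monoid (amalgam G H N i j)" unfolding M by (rule Inv_inverse_monoid)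
  show "\<alpha> \<in> mon_hom G (amalgam G H N i j)"
    unfolding M
  proof (rule mon_homI)
    show "\<alpha> x \<in> carrier (Inv X R)" if "x \<in> carrier G" for x
      using that by (simp add: \<alpha> Inv_carrier quotientI)
    show "\<alpha> \<one>\<^bsub>G\<^esub> = \<one>\<^bsub>Inv X R\<^esub>"
      unfolding \<alpha> Inv_one by (rule eqI) (auto simp: R_def mult_table_def)
    fix x y assume "x \<in> carrier G" "y \<in> carrier G"
    then show "\<alpha> (x \<otimes>\<^bsub>G\<^esub> y) = \<alpha> x \<otimes>\<^bsub>Inv X R\<^esub> \<alpha> y"
      unfolding \<alpha> by (subst Inv_mult; simp) (rule eqI[symmetric]; force simp: R_def mult_table_def)
  qed
  show "\<beta> \<in> mon_hom H (amalgam G H N i j)"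
    unfolding M
  proof (rule mon_homI)
    show "\<beta> x \<in> carrier (Inv X R)" if "x \<in> carrier H" for x
      using that by (simp add: \<beta> Inv_carrier quotientI)
    show "\<beta> \<one>\<^bsub>H\<^esub> = \<one>\<^bsub>Inv X R\<^esub>"
      unfolding \<beta> Inv_one by (rule eqI) (auto simp: R_def mult_table_def)
    fix x y assume "x \<in> carrier H" "y \<in> carrier H"
    then show "\<beta> (x \<otimes>\<^bsub>H\<^esub> y) = \<beta> x \<otimes>\<^bsub>Inv X R\<^esub> \<beta> y"
      unfolding \<beta> by (subst Inv_mult; simp) (rule eqI[symmetric]; force simp: R_def mult_table_def)
  qed
  show "\<alpha> (i n) = \<beta> (j n)" if "n \<in> carrier N" for n
    unfolding \<alpha> \<beta> using that mon_homD(1)[OF i that] mon_homD(1)[OF j that]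
    by (intro eqI) (auto simp: R_def)
  fix T :: "('t, 'l) monoid_scheme" and p q
  assume T: "inverse_monoid T" and p: "p \<in> mon_hom G T" and q: "q \<in> mon_hom H T"
    and pq: "\<And>n. n \<in> carrier N \<Longrightarrow> p (i n) = q (j n)"
  interpret T: inverse_monoid T by fact
  let ?f = "case_sum p q"
  have f: "?f ` X \<subseteq> carrier T" using mon_homD(1)[OF p] mon_homD(1)[OF q] by (auto simp: X_def)
  have ev: "word_eval T ?f u = word_eval T ?f v" if "(u, v) \<in> R" for u v
    using that mon_homD[OF p] mon_homD[OF q] mon_homD(1)[OF i] mon_homD(1)[OF j] pq
    by (auto simp: R_def mult_table_def)
  obtain h where h: "h \<in> mon_hom (Inv X R) T"
    "\<forall>x\<in>X. h (inv_cong X R `` {[(x, True)]}) = ?f x"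
    using Inv_universal[OF T f ev] by blast
  have uniq: "h' x = h x"
    if "h' \<in> mon_hom (Inv X R) T" "\<forall>a\<in>carrier G. h' (\<alpha> a) = p a" "\<forall>b\<in>carrier H. h' (\<beta> b) = q b"
      "x \<in> carrier (Inv X R)" for h' x
  proof (rule Inv_hom_unique[OF T that(1) h(1) _ that(4)])
    fix y assume "y \<in> X"
    then show "h' (inv_cong X R `` {[(y, True)]}) = h (inv_cong X R `` {[(y, True)]})"
      using h(2) that(2,3) by (cases y) (auto simp: \<alpha> \<beta>)
  qed
  show "\<exists>h \<in> mon_hom (amalgam G H N i j) T.
        (\<forall>a\<in>carrier G. h (\<alpha> a) = p a) \<and> (\<forall>b\<in>carrier H. h (\<beta> b) = q b) \<and>
        (\<forall>h' \<in> mon_hom (amalgam G H N i j) T.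
          (\<forall>a\<in>carrier G. h' (\<alpha> a) = p a) \<and> (\<forall>b\<in>carrier H. h' (\<beta> b) = q b) \<longrightarrow>
          (\<forall>x\<in>carrier (amalgam G H N i j). h' x = h x))"
    unfolding M using h uniq by (intro bexI[OF _ h(1)]) (auto simp: \<alpha> \<beta>)
qed

end

theory Submission
  imports Defs "HOL-Algebra.Bij"
begin

text \<open>Factoring out the minimum group congruences \<open>\<sigma>\<^sub>i\<close> turns the amalgam \<open>M\<close> into the amalgamated
  product of the groups \<open>M\<^sub>i/\<sigma>\<^sub>i\<close>; \<open>N\<close> is a group and still embeds, because an idempotent unit is
  \<open>1\<close>. By the normal form theorem, which is obtained from the action on normal forms, a product of
  elements of the \<open>M\<^sub>i\<close> that is trivial in this group is either not alternating, and two adjacent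
  letters merge, or has a letter congruent to some \<open>n \<in> N\<close>. Since \<open>M\<^sub>i\<close> is E-unitary, that letter is
  \<open>e n\<close> with \<open>e\<close> idempotent. A conjugate of \<open>e\<close> can be moved to the front as an idempotent and \<open>n\<close> be
  absorbed by a neighbouring letter. By induction on its length the product is idempotent, so the
  homomorphism from \<open>M\<close> to the group is idempotent-pure and \<open>M\<close> is E-unitary.

  For the presentation, the amalgamating relation \<open>u = v\<close> for a generator of \<open>N\<close> may be replaced by
  the special relation \<open>u v\<^sup>-\<^sup>1 = 1\<close>, because \<open>v\<close> is already a unit by the relations of \<open>M\<^sub>2\<close>.\<close>

section \<open>Amalgamated products of groups act on normal forms\<close>

lemma coset_representatives:
  assumes G: "group G" and N: "group N" and f: "f \<in> mon_hom N G"
  obtains r \<nu> where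
    "\<And>x. x \<in> carrier G \<Longrightarrow> r x \<in> carrier G"
    "\<And>x. x \<in> carrier G \<Longrightarrow> \<nu> x \<in> carrier N"
    "\<And>x. x \<in> carrier G \<Longrightarrow> f (\<nu> x) \<otimes>\<^bsub>G\<^esub> r x = x"
    "\<And>n x. n \<in> carrier N \<Longrightarrow> x \<in> carrier G \<Longrightarrow> r (f n \<otimes>\<^bsub>G\<^esub> x) = r x"
    "r \<one>\<^bsub>G\<^esub> = \<one>\<^bsub>G\<^esub>"
proof -
  interpret G: group G by fact
  interpret N: group N by fact
  note fD = mon_homD[OF f]
  have canc: "f (inv\<^bsub>N\<^esub> n) \<otimes>\<^bsub>G\<^esub> (f n \<otimes>\<^bsub>G\<^esub> x) = x" if "n \<in> carrier N" "x \<in> carrier G" for n x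
    using fD(1,3) fD(2)[of "inv\<^bsub>N\<^esub> n" n] that by (simp flip: G.m_assoc)
  define P where "P x y \<longleftrightarrow> y \<in> carrier G \<and> (x \<in> f ` carrier N \<longrightarrow> y = \<one>\<^bsub>G\<^esub>) \<and>
    (\<exists>n\<in>carrier N. x = f n \<otimes>\<^bsub>G\<^esub> y)" for x y
  have ex: "\<exists>y. P x y" if "x \<in> carrier G" for x
  proof (cases "x \<in> f ` carrier N")
    case True
    then have "P x \<one>\<^bsub>G\<^esub>" using fD(1) unfolding P_def by auto
    then show ?thesis by blast
  next
    case False
    moreover have "x = f \<one>\<^bsub>N\<^esub> \<otimes>\<^bsub>G\<^esub> x" using that fD(3) by simp
    ultimately have "P x x" using that unfolding P_def by blast
    then show ?thesis by blast
  qed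
  have imp: "P (f n \<otimes>\<^bsub>G\<^esub> x) y" if "P x y" "n \<in> carrier N" "x \<in> carrier G" for n x y
  proof -
    obtain m where m: "m \<in> carrier N" "x = f m \<otimes>\<^bsub>G\<^esub> y" "y \<in> carrier G"
      using \<open>P x y\<close> unfolding P_def by blast
    have "x \<in> f ` carrier N" if "f n \<otimes>\<^bsub>G\<^esub> x = f k" "k \<in> carrier N" for k
    proof -
      have "f (inv\<^bsub>N\<^esub> n \<otimes>\<^bsub>N\<^esub> k) = f (inv\<^bsub>N\<^esub> n) \<otimes>\<^bsub>G\<^esub> (f n \<otimes>\<^bsub>G\<^esub> x)" 
        using that fD(2)[of "inv\<^bsub>N\<^esub> n" k] \<open>n \<in> carrier N\<close> by simp
      also have "\<dots> = x" by (rule canc) fact+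
      finally show ?thesis using that \<open>n \<in> carrier N\<close> by (metis N.inv_closed N.m_closed imageI)
    qed
    moreover have "f n \<otimes>\<^bsub>G\<^esub> x = f (n \<otimes>\<^bsub>N\<^esub> m) \<otimes>\<^bsub>G\<^esub> y"
      using m fD(1,2) \<open>n \<in> carrier N\<close> by (simp add: G.m_assoc)
    ultimately show ?thesis using \<open>P x y\<close> N.m_closed[OF \<open>n \<in> carrier N\<close> m(1)] unfolding P_def by blast
  qed
  have eq: "P (f n \<otimes>\<^bsub>G\<^esub> x) = P x" if "n \<in> carrier N" "x \<in> carrier G" for n x
  proof (rule ext, rule iffI)
    fix y assume "P (f n \<otimes>\<^bsub>G\<^esub> x) y"
    then have "P (f (inv\<^bsub>N\<^esub> n) \<otimes>\<^bsub>G\<^esub> (f n \<otimes>\<^bsub>G\<^esub> x)) y" using imp that fD by simp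
    then show "P x y" using canc that by simp
  qed (use imp that in blast)
  define r where "r x = (SOME y. P x y)" for x
  have r: "P x (r x)" if "x \<in> carrier G" for x
    unfolding r_def using ex[OF that] by (rule someI_ex)
  have "\<exists>n. n \<in> carrier N \<and> x = f n \<otimes>\<^bsub>G\<^esub> r x" if "x \<in> carrier G" for x
    using r[OF that] by (auto simp: P_def)
  then obtain \<nu> where \<nu>: "\<And>x. x \<in> carrier G \<Longrightarrow> \<nu> x \<in> carrier N \<and> x = f (\<nu> x) \<otimes>\<^bsub>G\<^esub> r x" by metis
  have "r \<one>\<^bsub>G\<^esub> = \<one>\<^bsub>G\<^esub>" using r[of "\<one>\<^bsub>G\<^esub>"] fD(3) unfolding P_def by (metis G.one_closed N.one_closed imageI)
  moreover have "r (f n \<otimes>\<^bsub>G\<^esub> x) = r x" if "n \<in> carrier N" "x \<in> carrier G" for n x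
    unfolding r_def eq[OF that] ..
  ultimately show thesis using that[of r \<nu>] r \<nu> by (simp add: P_def)
qed

text \<open>One factor \<open>G\<close> of the amalgamated product. The pair \<open>(n, s)\<close> stands for the normal form
  \<open>n s\<close>; \<open>pull\<close> and \<open>push\<close> are mutually inverse bijections between the normal forms and the pairs
  of an element of \<open>G\<close> and a normal form without \<open>N\<close>-part that does not start with a letter
  of \<open>G\<close>, on which \<open>G\<close> acts by left multiplication.\<close>

locale amalgam_factor = G: group G + N: group N
  for G (structure) and N (structure) +
  fixes f :: "'c \<Rightarrow> 'a" and r :: "'a \<Rightarrow> 'a" and \<nu> :: "'a \<Rightarrow> 'c"
    and c :: "'a \<Rightarrow> 'l" and d :: "'l \<Rightarrow> 'a" and side :: "'l \<Rightarrow> bool" and S :: "'l list set"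
  assumes f: "f \<in> mon_hom N G" and inj: "inj_on f (carrier N)"
    and r_closed [simp]: "x \<in> carrier G \<Longrightarrow> r x \<in> carrier G"
    and \<nu>_closed [simp]: "x \<in> carrier G \<Longrightarrow> \<nu> x \<in> carrier N"
    and decomp: "x \<in> carrier G \<Longrightarrow> f (\<nu> x) \<otimes>\<^bsub>G\<^esub> r x = x"
    and r_coset: "n \<in> carrier N \<Longrightarrow> x \<in> carrier G \<Longrightarrow> r (f n \<otimes>\<^bsub>G\<^esub> x) = r x"
    and r_one: "r \<one>\<^bsub>G\<^esub> = \<one>\<^bsub>G\<^esub>"
    and d_c [simp]: "d (c x) = x" and side_c [simp]: "side (c x)"
    and S_Cons: "t \<in> r ` carrier G - {\<one>\<^bsub>G\<^esub>} \<Longrightarrow> s \<in> S \<Longrightarrow> s = [] \<or> \<not> side (hd s) \<Longrightarrow> c t # s \<in> S"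
    and S_dest: "l # s \<in> S \<Longrightarrow> side l \<Longrightarrow>
      (\<exists>t \<in> r ` carrier G - {\<one>\<^bsub>G\<^esub>}. l = c t) \<and> s \<in> S \<and> (s = [] \<or> \<not> side (hd s))"
begin

lemma f_closed [simp]: "n \<in> carrier N \<Longrightarrow> f n \<in> carrier G"
  and f_mult: "n \<in> carrier N \<Longrightarrow> m \<in> carrier N \<Longrightarrow> f (n \<otimes>\<^bsub>N\<^esub> m) = f n \<otimes> f m"
  and f_one: "f \<one>\<^bsub>N\<^esub> = \<one>"
  using mon_homD[OF f] by auto

lemma \<nu>_coset:
  assumes "n \<in> carrier N" "x \<in> carrier G"
  shows "\<nu> (f n \<otimes> x) = n \<otimes>\<^bsub>N\<^esub> \<nu> x"
proof -
  have "f (\<nu> (f n \<otimes> x)) \<otimes> r x = f n \<otimes> (f (\<nu> x) \<otimes> r x)"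
    using decomp[of "f n \<otimes> x"] decomp[of x] assms by (simp add: r_coset)
  also have "\<dots> = f (n \<otimes>\<^bsub>N\<^esub> \<nu> x) \<otimes> r x" using assms by (simp add: f_mult G.m_assoc)
  finally have "f (\<nu> (f n \<otimes> x)) = f (n \<otimes>\<^bsub>N\<^esub> \<nu> x)" using assms by simp
  then show ?thesis using inj assms by (auto dest: inj_onD)
qed

lemma r_idem: "x \<in> carrier G \<Longrightarrow> r (r x) = r x"
  using r_coset[of "\<nu> x" "r x"] decomp[of x] by simp

lemma \<nu>_r:
  assumes "x \<in> carrier G"
  shows "\<nu> (r x) = \<one>\<^bsub>N\<^esub>"
proof -
  have "f (\<nu> (r x)) \<otimes> r x = r x" using decomp[of "r x"] assms by (simp add: r_idem)
  then have "f (\<nu> (r x)) = f \<one>\<^bsub>N\<^esub>" using assms by (simp add: f_one)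
  then show ?thesis using inj assms by (auto dest: inj_onD)
qed

lemma \<nu>_one: "\<nu> \<one> = \<one>\<^bsub>N\<^esub>"
  using \<nu>_r[of \<one>] r_one by simp

lemma r_eq_one: "x \<in> carrier G \<Longrightarrow> r x = \<one> \<Longrightarrow> x \<in> f ` carrier N"
  using decomp[of x] by (metis G.r_one \<nu>_closed f_closed imageI)

definition push :: "'a \<Rightarrow> 'l list \<Rightarrow> 'c \<times> 'l list" where
  "push x s = (\<nu> x, if r x = \<one> then s else c (r x) # s)"

definition pull :: "'c \<times> 'l list \<Rightarrow> 'a \<times> 'l list" where
  "pull = (\<lambda>(n, s). if s \<noteq> [] \<and> side (hd s) then (f n \<otimes> d (hd s), tl s) else (f n, s))"

definition act :: "'a \<Rightarrow> 'c \<times> 'l list \<Rightarrow> 'c \<times> 'l list" where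
  "act g \<omega> = push (g \<otimes> fst (pull \<omega>)) (snd (pull \<omega>))"

lemma push_closed:
  "x \<in> carrier G \<Longrightarrow> s \<in> S \<Longrightarrow> s = [] \<or> \<not> side (hd s) \<Longrightarrow> push x s \<in> carrier N \<times> S"
  by (auto simp: push_def S_Cons)

lemma pull_push:
  assumes "x \<in> carrier G" "s = [] \<or> \<not> side (hd s)"
  shows "pull (push x s) = (x, s)"
proof (cases "r x = \<one>")
  case True
  then have "f (\<nu> x) = x" using decomp[OF assms(1)] assms by simp
  then show ?thesis using True assms by (auto simp: pull_def push_def)
next
  case False
  then show ?thesis using decomp[OF assms(1)] by (simp add: pull_def push_def)
qed

lemma pull:
  assumes "\<omega> \<in> carrier N \<times> S"
  shows "fst (pull \<omega>) \<in> carrier G" "snd (pull \<omega>) \<in> S"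
    "snd (pull \<omega>) = [] \<or> \<not> side (hd (snd (pull \<omega>)))"
    "push (fst (pull \<omega>)) (snd (pull \<omega>)) = \<omega>"
    "n \<in> carrier N \<Longrightarrow> pull (n \<otimes>\<^bsub>N\<^esub> fst \<omega>, snd \<omega>) = (f n \<otimes> fst (pull \<omega>), snd (pull \<omega>))"
proof -
  obtain m s where \<omega>: "\<omega> = (m, s)" "m \<in> carrier N" "s \<in> S" using assms by auto
  have *: "fst (pull \<omega>) \<in> carrier G \<and> snd (pull \<omega>) \<in> S \<and>
    (snd (pull \<omega>) = [] \<or> \<not> side (hd (snd (pull \<omega>)))) \<and>
    push (fst (pull \<omega>)) (snd (pull \<omega>)) = \<omega> \<and>
    (n \<in> carrier N \<longrightarrow> pull (n \<otimes>\<^bsub>N\<^esub> fst \<omega>, snd \<omega>) = (f n \<otimes> fst (pull \<omega>), snd (pull \<omega>)))" for n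
  proof (cases "s \<noteq> [] \<and> side (hd s)")
    case True
    then obtain l s' where s: "s = l # s'" "side l" by (cases s) auto
    then obtain x where x: "x \<in> carrier G" "r x \<noteq> \<one>" "l = c (r x)" "s' \<in> S" "s' = [] \<or> \<not> side (hd s')"
      using S_dest[of l s'] \<omega>(3) by auto
    then show ?thesis
      using \<omega> s by (auto simp: pull_def push_def r_coset \<nu>_coset r_idem \<nu>_r f_mult G.m_assoc)
  next
    case False
    have "r (f m) = \<one>" "\<nu> (f m) = m"
      using r_coset[of m \<one>] \<nu>_coset[of m \<one>] \<omega>(2) by (simp_all add: r_one \<nu>_one)
    then show ?thesis using False \<omega> by (auto simp: pull_def push_def f_mult)
  qed
  then show "fst (pull \<omega>) \<in> carrier G" "snd (pull \<omega>) \<in> S"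
    "snd (pull \<omega>) = [] \<or> \<not> side (hd (snd (pull \<omega>)))"
    "push (fst (pull \<omega>)) (snd (pull \<omega>)) = \<omega>"
    "n \<in> carrier N \<Longrightarrow> pull (n \<otimes>\<^bsub>N\<^esub> fst \<omega>, snd \<omega>) = (f n \<otimes> fst (pull \<omega>), snd (pull \<omega>))"
    by auto
qed

lemma act_closed: "g \<in> carrier G \<Longrightarrow> \<omega> \<in> carrier N \<times> S \<Longrightarrow> act g \<omega> \<in> carrier N \<times> S"
  unfolding act_def by (intro push_closed) (auto simp: pull)

lemma act_mult:
  "g \<in> carrier G \<Longrightarrow> h \<in> carrier G \<Longrightarrow> \<omega> \<in> carrier N \<times> S \<Longrightarrow> act (g \<otimes> h) \<omega> = act g (act h \<omega>)"
  by (simp add: act_def pull pull_push G.m_assoc)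

lemma act_one: "\<omega> \<in> carrier N \<times> S \<Longrightarrow> act \<one> \<omega> = \<omega>"
  by (simp add: act_def pull)

lemma act_f: "n \<in> carrier N \<Longrightarrow> m \<in> carrier N \<Longrightarrow> s \<in> S \<Longrightarrow> act (f n) (m, s) = (n \<otimes>\<^bsub>N\<^esub> m, s)"
  using pull(4)[of "(n \<otimes>\<^bsub>N\<^esub> m, s)"] pull(5)[of "(m, s)" n] by (simp add: act_def)

lemma act_new_letter:
  assumes "x \<in> carrier G" "x \<notin> f ` carrier N" "n \<in> carrier N" "s = [] \<or> \<not> side (hd s)"
  shows "\<exists>m t. act x (n, s) = (m, c t # s)"
proof -
  have "x \<otimes> f n \<notin> f ` carrier N"
  proof
    assume "x \<otimes> f n \<in> f ` carrier N"
    then obtain k where k: "k \<in> carrier N" "x \<otimes> f n = f k" by auto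
    have "x = x \<otimes> f (n \<otimes>\<^bsub>N\<^esub> inv\<^bsub>N\<^esub> n)" using assms by (simp add: f_one)
    also have "\<dots> = f k \<otimes> f (inv\<^bsub>N\<^esub> n)"
      using assms N.inv_closed[of n] unfolding k(2)[symmetric]
      by (simp only: f_mult G.m_assoc f_closed)
    also have "\<dots> = f (k \<otimes>\<^bsub>N\<^esub> inv\<^bsub>N\<^esub> n)" using assms k by (simp add: f_mult)
    finally show False using assms k by (metis N.inv_closed N.m_closed imageI)
  qed
  then have "r (x \<otimes> f n) \<noteq> \<one>" using r_eq_one[of "x \<otimes> f n"] assms by auto
  then show ?thesis using assms by (auto simp: act_def pull_def push_def)
qed

lemma act_hom: "(\<lambda>g. restrict (act g) (carrier N \<times> S)) \<in> mon_hom G (BijGroup (carrier N \<times> S))"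
proof (rule mon_homI)
  let ?\<Omega> = "carrier N \<times> S"
  have bij: "restrict (act g) ?\<Omega> \<in> Bij ?\<Omega>" if g: "g \<in> carrier G" for g
  proof -
    have "bij_betw (act g) ?\<Omega> ?\<Omega>"
    proof (rule bij_betw_byWitness[where f' = "act (inv g)"])
      show "\<forall>\<omega>\<in>?\<Omega>. act (inv g) (act g \<omega>) = \<omega>" "\<forall>\<omega>\<in>?\<Omega>. act g (act (inv g) \<omega>) = \<omega>"
        using g act_mult[of "inv g" g] act_mult[of g "inv g"] act_one by auto
      show "act g ` ?\<Omega> \<subseteq> ?\<Omega>" "act (inv g) ` ?\<Omega> \<subseteq> ?\<Omega>"
        using act_closed[OF g] act_closed[of "inv g"] g by blast+
    qed
    then show ?thesis by (simp add: Bij_def)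
  qed
  then show "restrict (act g) ?\<Omega> \<in> carrier (BijGroup ?\<Omega>)" if "g \<in> carrier G" for g
    using that by (simp add: BijGroup_def)
  show "restrict (act \<one>) ?\<Omega> = \<one>\<^bsub>BijGroup ?\<Omega>\<^esub>"
    by (auto simp: BijGroup_def act_one)
  fix g h assume gh: "g \<in> carrier G" "h \<in> carrier G"
  then show "restrict (act (g \<otimes> h)) ?\<Omega> =
      restrict (act g) ?\<Omega> \<otimes>\<^bsub>BijGroup ?\<Omega>\<^esub> restrict (act h) ?\<Omega>"
    using bij[OF gh(1)] bij[OF gh(2)] act_closed[OF gh(2)]
    by (auto simp: BijGroup_def compose_def act_mult intro!: restrict_ext)
qed

end

definition prod_letters :: "('g, 'm) monoid_scheme \<Rightarrow> ('l \<Rightarrow> 'g) \<Rightarrow> 'l list \<Rightarrow> 'g" where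
  "prod_letters G p w = foldr (\<lambda>x y. p x \<otimes>\<^bsub>G\<^esub> y) w \<one>\<^bsub>G\<^esub>"

lemma prod_letters_simps [simp]:
  "prod_letters G p [] = \<one>\<^bsub>G\<^esub>"
  "prod_letters G p (x # w) = p x \<otimes>\<^bsub>G\<^esub> prod_letters G p w"
  by (simp_all add: prod_letters_def)

theorem group_amalgam_normal_form:
  fixes A :: "('a, 'm) monoid_scheme" and B :: "('b, 'n) monoid_scheme" and N :: "('c, 'k) monoid_scheme"
  assumes A: "group A" and B: "group B" and N: "group N"
    and f: "f \<in> mon_hom N A" "inj_on f (carrier N)" and g: "g \<in> mon_hom N B" "inj_on g (carrier N)"
  obtains T :: "('c \<times> ('a + 'b) list \<Rightarrow> 'c \<times> ('a + 'b) list) monoid" and p q where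
    "group T" "p \<in> mon_hom A T" "q \<in> mon_hom B T"
    "\<And>n. n \<in> carrier N \<Longrightarrow> p (f n) = q (g n)"
    "\<And>n. n \<in> carrier N \<Longrightarrow> p (f n) = \<one>\<^bsub>T\<^esub> \<Longrightarrow> n = \<one>\<^bsub>N\<^esub>"
    "\<And>w. w \<noteq> [] \<Longrightarrow> set w \<subseteq> (carrier A - f ` carrier N) <+> (carrier B - g ` carrier N) \<Longrightarrow>
      successively (\<lambda>x y. isl x \<noteq> isl y) w \<Longrightarrow> prod_letters T (case_sum p q) w \<noteq> \<one>\<^bsub>T\<^esub>"
proof -
  obtain r \<nu> where r: "\<And>x. x \<in> carrier A \<Longrightarrow> r x \<in> carrier A"
    "\<And>x. x \<in> carrier A \<Longrightarrow> \<nu> x \<in> carrier N"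
    "\<And>x. x \<in> carrier A \<Longrightarrow> f (\<nu> x) \<otimes>\<^bsub>A\<^esub> r x = x"
    "\<And>n x. n \<in> carrier N \<Longrightarrow> x \<in> carrier A \<Longrightarrow> r (f n \<otimes>\<^bsub>A\<^esub> x) = r x"
    "r \<one>\<^bsub>A\<^esub> = \<one>\<^bsub>A\<^esub>"
    using coset_representatives[OF A N f(1)] by metis
  obtain r' \<nu>' where r': "\<And>x. x \<in> carrier B \<Longrightarrow> r' x \<in> carrier B"
    "\<And>x. x \<in> carrier B \<Longrightarrow> \<nu>' x \<in> carrier N"
    "\<And>x. x \<in> carrier B \<Longrightarrow> g (\<nu>' x) \<otimes>\<^bsub>B\<^esub> r' x = x"
    "\<And>n x. n \<in> carrier N \<Longrightarrow> x \<in> carrier B \<Longrightarrow> r' (g n \<otimes>\<^bsub>B\<^esub> x) = r' x"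
    "r' \<one>\<^bsub>B\<^esub> = \<one>\<^bsub>B\<^esub>"
    using coset_representatives[OF B N g(1)] by metis
  define S where "S = {s. set s \<subseteq> (r ` carrier A - {\<one>\<^bsub>A\<^esub>}) <+> (r' ` carrier B - {\<one>\<^bsub>B\<^esub>}) \<and>
    successively (\<lambda>x y. isl x \<noteq> isl y) s}"
  interpret FA: amalgam_factor A N f r \<nu> Inl projl isl S
    unfolding amalgam_factor_def amalgam_factor_axioms_def
    using A N f r by (auto simp: S_def successively_Cons)
  interpret FB: amalgam_factor B N g r' \<nu>' Inr projr "Not \<circ> isl" S
    unfolding amalgam_factor_def amalgam_factor_axioms_def
    using B N g r' by (auto simp: S_def successively_Cons)
  define \<Omega> where "\<Omega> = carrier N \<times> S"
  define T where "T = BijGroup \<Omega>"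
  define p where "p x = restrict (FA.act x) \<Omega>" for x
  define q where "q x = restrict (FB.act x) \<Omega>" for x
  interpret T: group T unfolding T_def by (rule group_BijGroup)
  have p: "p \<in> mon_hom A T" and q: "q \<in> mon_hom B T"
    using FA.act_hom FB.act_hom unfolding p_def q_def T_def \<Omega>_def by (simp_all add: fun_eq_iff)
  define \<omega> where "\<omega> = (\<one>\<^bsub>N\<^esub>, [] :: ('a + 'b) list)"
  have \<omega>: "\<omega> \<in> \<Omega>" by (simp add: \<omega>_def \<Omega>_def S_def)
  have \<omega>_nil: "snd \<omega> = []" by (simp add: \<omega>_def)
  have T_mult: "(x \<otimes>\<^bsub>T\<^esub> y) \<omega>' = x (y \<omega>')" if "x \<in> carrier T" "y \<in> carrier T" "\<omega>' \<in> \<Omega>" for x y \<omega>'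
    using that by (simp add: T_def BijGroup_def compose_def)
  have T_one: "\<one>\<^bsub>T\<^esub> \<omega> = \<omega>" using \<omega> by (simp add: T_def BijGroup_def)
  show thesis
  proof (rule that[OF T.group_axioms p q])
    show "p (f n) = q (g n)" if "n \<in> carrier N" for n
      unfolding p_def q_def \<Omega>_def using that by (auto intro!: restrict_ext simp: FA.act_f FB.act_f)
    show "n = \<one>\<^bsub>N\<^esub>" if "n \<in> carrier N" "p (f n) = \<one>\<^bsub>T\<^esub>" for n
    proof -
      have "p (f n) \<omega> = (n, [])"
        using that(1) \<omega> FA.act_f[of n "\<one>\<^bsub>N\<^esub>" "[]"] by (simp add: p_def \<omega>_def \<Omega>_def)
      then show ?thesis using that(2) T_one by (simp add: \<omega>_def)
    qed
    fix w :: "('a + 'b) list"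
    let ?P = "prod_letters T (case_sum p q)"
    assume w: "w \<noteq> []" "set w \<subseteq> (carrier A - f ` carrier N) <+> (carrier B - g ` carrier N)"
      "successively (\<lambda>x y. isl x \<noteq> isl y) w"
    from w(2,3) have "?P w \<in> carrier T \<and> ?P w \<omega> \<in> \<Omega> \<and>
      (if w = [] then snd (?P w \<omega>) = [] else snd (?P w \<omega>) \<noteq> [] \<and> isl (hd (snd (?P w \<omega>))) = isl (hd w))"
    proof (induction w)
      case Nil
      then show ?case using \<omega> T_one by (simp add: \<omega>_def)
    next
      case (Cons x w)
      then have "successively (\<lambda>x y. isl x \<noteq> isl y) w" by (auto simp: successively_Cons)
      with Cons.IH Cons.prems(1) have "?P w \<in> carrier T \<and> ?P w \<omega> \<in> \<Omega> \<and>
        (if w = [] then snd (?P w \<omega>) = [] else snd (?P w \<omega>) \<noteq> [] \<and> isl (hd (snd (?P w \<omega>))) = isl (hd w))"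
        by (auto simp: T_one \<omega>_nil)
      then have IH: "?P w \<in> carrier T" "?P w \<omega> \<in> \<Omega>"
        "if w = [] then snd (?P w \<omega>) = [] else snd (?P w \<omega>) \<noteq> [] \<and> isl (hd (snd (?P w \<omega>))) = isl (hd w)"
        by blast+
      obtain n s where ns: "?P w \<omega> = (n, s)" "n \<in> carrier N" "s \<in> S"
        using IH(2) by (auto simp: \<Omega>_def)
      have s: "s = [] \<or> isl (hd s) \<noteq> isl x"
        using IH(3) Cons.prems(2) ns(1) by (auto simp: successively_Cons split: if_splits)
      have x: "case_sum p q x \<in> carrier T"
        using Cons.prems(1) mon_homD(1)[OF p] mon_homD(1)[OF q] by auto
      have ev: "?P (x # w) \<omega> = case_sum p q x (n, s)" using T_mult[OF x IH(1) \<omega>] ns(1) by simp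
      show ?case
      proof (cases x)
        case (Inl a)
        then have a: "a \<in> carrier A" "a \<notin> f ` carrier N" using Cons.prems(1) by auto
        obtain m t where "FA.act a (n, s) = (m, Inl t # s)"
          using FA.act_new_letter[OF a ns(2), of s] s Inl by auto
        moreover have "FA.act a (n, s) \<in> \<Omega>" using FA.act_closed[OF a(1)] ns unfolding \<Omega>_def by simp
        ultimately show ?thesis using Inl ev x IH(1) IH(2) ns(1) by (simp add: p_def)
      next
        case (Inr b)
        then have b: "b \<in> carrier B" "b \<notin> g ` carrier N" using Cons.prems(1) by auto
        obtain m t where "FB.act b (n, s) = (m, Inr t # s)"
          using FB.act_new_letter[OF b ns(2), of s] s Inr by auto
        moreover have "FB.act b (n, s) \<in> \<Omega>" using FB.act_closed[OF b(1)] ns unfolding \<Omega>_def by simp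
        ultimately show ?thesis using Inr ev x IH(1) IH(2) ns(1) by (simp add: q_def)
      qed
    qed
    then show "?P w \<noteq> \<one>\<^bsub>T\<^esub>" using T_one w(1) by (auto simp: \<omega>_def)
  qed
qed

section \<open>E-unitarity\<close>

lemma group_is_inverse_monoid:
  fixes G (structure)
  assumes "group G"
  shows "inverse_monoid G"
proof -
  interpret group G by fact
  show ?thesis
  proof (unfold_locales, rule ex_ex1I)
    fix x assume x: "x \<in> carrier G"
    then show "\<exists>y. y \<in> carrier G \<and> x \<otimes> y \<otimes> x = x \<and> y \<otimes> x \<otimes> y = y"
      by (intro exI[of _ "inv x"]) simp
    have "y = inv x" if "y \<in> carrier G" "x \<otimes> y \<otimes> x = x" for y
    proof -
      have "x \<otimes> (y \<otimes> x) = x \<otimes> \<one>" using that x by (simp add: m_assoc)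
      then have "y \<otimes> x = \<one>" using that x by (metis Units_l_cancel Units_eq m_closed one_closed)
      then show ?thesis using that x inv_equality by simp
    qed
    then show "y = z" if "y \<in> carrier G \<and> x \<otimes> y \<otimes> x = x \<and> y \<otimes> x \<otimes> y = y"
      "z \<in> carrier G \<and> x \<otimes> z \<otimes> x = x \<and> z \<otimes> x \<otimes> z = z" for y z
      using that by metis
  qed
qed

lemma (in inverse_monoid) minv_Units:
  assumes "x \<in> Units G"
  shows "minv G x \<otimes> x = \<one>" "x \<otimes> minv G x = \<one>"
proof -
  have "minv G x = inv x" using assms by (intro minv_unique) auto
  then show "minv G x \<otimes> x = \<one>" "x \<otimes> minv G x = \<one>" using assms by simp_all
qed

lemma (in monoid) idem_Units: "x \<in> Units G \<Longrightarrow> x \<otimes> x = x \<Longrightarrow> x = \<one>"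
  by (metis Units_closed Units_l_inv Units_inv_closed m_assoc l_one)

lemma mon_hom_Units:
  assumes h: "h \<in> mon_hom G H" and "monoid G" and x: "x \<in> Units G"
  shows "h x \<in> Units H"
proof -
  interpret monoid G by fact
  have c: "x \<in> carrier G" "inv\<^bsub>G\<^esub> x \<in> carrier G" using x by auto
  have "h (inv\<^bsub>G\<^esub> x) \<otimes>\<^bsub>H\<^esub> h x = \<one>\<^bsub>H\<^esub>" "h x \<otimes>\<^bsub>H\<^esub> h (inv\<^bsub>G\<^esub> x) = \<one>\<^bsub>H\<^esub>"
    using c x mon_homD(3)[OF h] by (simp_all flip: mon_homD(2)[OF h])
  then show ?thesis using mon_homD(1)[OF h] c unfolding Units_def by blast
qed

lemma mon_hom_comp: "g \<in> mon_hom G H \<Longrightarrow> h \<in> mon_hom H K \<Longrightarrow> (h \<circ> g) \<in> mon_hom G K"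
  by (rule mon_homI) (auto simp: mon_homD)

lemma mon_hom_prod_letters:
  assumes h: "h \<in> mon_hom G H" and "monoid G" and "p ` set w \<subseteq> carrier G"
  shows "h (prod_letters G p w) = prod_letters H (h \<circ> p) w \<and> prod_letters G p w \<in> carrier G"
proof -
  interpret monoid G by fact
  show ?thesis using assms(3) mon_homD[OF h] by (induction w) auto
qed

lemma (in monoid) prod_letters_append:
  assumes "p ` set u \<subseteq> carrier G" "p ` set v \<subseteq> carrier G"
  shows "prod_letters G p (u @ v) = prod_letters G p u \<otimes> prod_letters G p v"
proof -
  have c: "prod_letters G p w \<in> carrier G" if "p ` set w \<subseteq> carrier G" for w
    using that by (induction w) auto
  show ?thesis using assms(1) c[OF assms(2)] by (induction u) (auto simp: m_assoc c)
qed

lemma mon_hom_idem_group: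
  assumes h: "h \<in> mon_hom M T" and T: "group T" and x: "x \<in> carrier M" "x \<otimes>\<^bsub>M\<^esub> x = x"
  shows "h x = \<one>\<^bsub>T\<^esub>"
proof -
  interpret T: group T by fact
  have "h x \<otimes>\<^bsub>T\<^esub> h x = h x" using mon_homD(2)[OF h x(1) x(1)] x by simp
  then show ?thesis using mon_homD(1)[OF h x(1)] by simp
qed

lemma quot_monoid_hom:
  fixes M (structure)
  assumes r: "mon_congruence M r"
  shows "(\<lambda>x. r `` {x}) \<in> mon_hom M (quot_monoid M r)"
  by (rule mon_homI, simp_all add: quot_mult[OF r]) (simp_all add: quot_monoid_def quotientI)

lemma E_unitary_idem_pure_hom:
  assumes "E_unitary M"
  obtains Q :: "'a set monoid" and \<pi> where "group Q" "\<pi> \<in> mon_hom (M :: ('a, 'm) monoid_scheme) Q"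
    "\<And>x. x \<in> carrier M \<Longrightarrow> \<pi> x = \<one>\<^bsub>Q\<^esub> \<longleftrightarrow> x \<otimes>\<^bsub>M\<^esub> x = x"
proof -
  interpret E_unitary M by fact
  define r where "r = min_group_cong M"
  have r: "mon_congruence M r" "group (quot_monoid M r)"
    using min_group_cong_least(1) unfolding r_def group_congruence_def by auto
  then have eq: "equiv (carrier M) r" by (simp add: mon_congruence_def)
  show thesis
  proof (rule that[OF r(2)])
    show "(\<lambda>x. r `` {x}) \<in> mon_hom M (quot_monoid M r)"
      by (rule quot_monoid_hom[OF r(1)])
    fix x assume x: "x \<in> carrier M"
    have "r `` {x} = \<one>\<^bsub>quot_monoid M r\<^esub> \<longleftrightarrow> (x, \<one>\<^bsub>M\<^esub>) \<in> r"
      using eq_equiv_class_iff[OF eq x one_closed] by (simp add: quot_monoid_def)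
    then show "r `` {x} = \<one>\<^bsub>quot_monoid M r\<^esub> \<longleftrightarrow> x \<otimes>\<^bsub>M\<^esub> x = x"
      using sigma_one_iff_idem[OF x] by (simp add: r_def)
  qed
qed

lemma E_unitaryI_idem_pure_hom:
  assumes M: "inverse_monoid M" and T: "group T" and h: "h \<in> mon_hom M T"
    and pure: "\<And>x. x \<in> carrier M \<Longrightarrow> h x = \<one>\<^bsub>T\<^esub> \<Longrightarrow> x \<otimes>\<^bsub>M\<^esub> x = x"
  shows "E_unitary M"
proof -
  interpret inverse_monoid M by fact
  define r where "r = {(x, y). x \<in> carrier M \<and> y \<in> carrier M \<and> h x = h y}"
  have r: "mon_congruence M r"
    unfolding mon_congruence_def equiv_def refl_on_def sym_def trans_def
    using mon_homD(2)[OF h] by (auto simp: r_def)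
  have "(minv M x \<otimes>\<^bsub>M\<^esub> x, \<one>\<^bsub>M\<^esub>) \<in> r" if "x \<in> carrier M" for x
    using that mon_hom_idem_group[OF h T, of "minv M x \<otimes>\<^bsub>M\<^esub> x"] minv_idem minv_props(1) mon_homD(3)[OF h]
    by (simp add: r_def)
  then have gr: "group_congruence M r"
    unfolding group_congruence_def group_quot_iff[OF monoid_axioms r] using r minv_props(1) by blast
  let ?\<sigma> = "min_group_cong M"
  have \<sigma>: "mon_congruence M ?\<sigma>" "group (quot_monoid M ?\<sigma>)"
    using min_group_cong_least(1) unfolding group_congruence_def by auto
  then have eq: "equiv (carrier M) ?\<sigma>" by (simp add: mon_congruence_def)
  have quot: "(\<lambda>x. ?\<sigma> `` {x}) \<in> mon_hom M (quot_monoid M ?\<sigma>)"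
    by (rule quot_monoid_hom[OF \<sigma>(1)])
  show ?thesis
  proof unfold_locales
    fix x assume x: "x \<in> carrier M"
    show "(x, \<one>\<^bsub>M\<^esub>) \<in> ?\<sigma> \<longleftrightarrow> x \<otimes>\<^bsub>M\<^esub> x = x"
    proof
      assume "(x, \<one>\<^bsub>M\<^esub>) \<in> ?\<sigma>"
      then have "(x, \<one>\<^bsub>M\<^esub>) \<in> r" using min_group_cong_least(2)[OF gr] by auto
      then show "x \<otimes>\<^bsub>M\<^esub> x = x" using pure x mon_homD(3)[OF h] by (simp add: r_def)
    next
      assume "x \<otimes>\<^bsub>M\<^esub> x = x"
      then have "?\<sigma> `` {x} = ?\<sigma> `` {\<one>\<^bsub>M\<^esub>}"
        using mon_hom_idem_group[OF quot \<sigma>(2) x] by (simp add: quot_monoid_def)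
      then show "(x, \<one>\<^bsub>M\<^esub>) \<in> ?\<sigma>" using eq_equiv_class_iff[OF eq x one_closed] by simp
    qed
  qed
qed

lemma group_if_embeds_in_Units:
  assumes N: "inverse_monoid N" and M: "monoid M" and i: "i \<in> mon_hom N M" "inj_on i (carrier N)"
    "i ` carrier N \<subseteq> Units M"
  shows "group N"
proof -
  interpret N: inverse_monoid N by fact
  interpret M: monoid M by fact
  have "minv N n \<otimes>\<^bsub>N\<^esub> n = \<one>\<^bsub>N\<^esub>" if n: "n \<in> carrier N" for n
  proof -
    let ?e = "minv N n \<otimes>\<^bsub>N\<^esub> n"
    have e: "?e \<in> carrier N" using n N.minv_props(1) by simp
    then have "i ?e \<otimes>\<^bsub>M\<^esub> i ?e = i ?e" using mon_homD(2)[OF i(1), of ?e ?e] N.minv_idem(2)[OF n] by simp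
    then have "i ?e = i \<one>\<^bsub>N\<^esub>" using M.idem_Units[of "i ?e"] i(3) e mon_homD(3)[OF i(1)] by auto
    then show ?thesis using i(2) e by (auto dest: inj_onD)
  qed
  then show ?thesis using N.minv_props(1) by (intro N.group_l_invI) blast
qed

lemma (in inverse_monoid) idem_conj:
  assumes u: "u \<in> carrier G" and e: "e \<in> carrier G" "e \<otimes> e = e"
  defines "f \<equiv> u \<otimes> e \<otimes> minv G u"
  shows "u \<otimes> e = f \<otimes> u" "f \<in> carrier G" "f \<otimes> f = f"
proof -
  let ?v = "minv G u"
  have v: "?v \<in> carrier G" using u minv_props by auto
  have com: "?v \<otimes> u \<otimes> e = e \<otimes> (?v \<otimes> u)" using idem_commute[of "?v \<otimes> u" e] minv_idem[OF u] u v e by simp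
  have "u \<otimes> e = u \<otimes> ?v \<otimes> u \<otimes> e" using minv_props(2)[OF u] by simp
  also have "\<dots> = u \<otimes> (?v \<otimes> u \<otimes> e)" using u v e by (simp add: m_assoc)
  also have "\<dots> = f \<otimes> u" unfolding com f_def using u v e by (simp add: m_assoc)
  finally show 1: "u \<otimes> e = f \<otimes> u" .
  show f: "f \<in> carrier G" unfolding f_def using u v e by simp
  have "f \<otimes> f = f \<otimes> u \<otimes> e \<otimes> ?v" using u v e f by (simp add: f_def m_assoc)
  also have "\<dots> = u \<otimes> (e \<otimes> e) \<otimes> ?v" unfolding 1[symmetric] using u v e(1) by (simp add: m_assoc)
  finally show "f \<otimes> f = f" by (simp add: e f_def)
qed

lemma idem_pure_unit_factor:
  assumes M: "monoid M" and \<pi>: "\<pi> \<in> mon_hom M Q"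
    and pure: "\<And>x. x \<in> carrier M \<Longrightarrow> \<pi> x = \<one>\<^bsub>Q\<^esub> \<longleftrightarrow> x \<otimes>\<^bsub>M\<^esub> x = x"
    and a: "a \<in> carrier M" and u: "u \<in> Units M" and eq: "\<pi> a = \<pi> u"
  shows "\<exists>e\<in>carrier M. e \<otimes>\<^bsub>M\<^esub> e = e \<and> a = e \<otimes>\<^bsub>M\<^esub> u"
proof -
  interpret monoid M by fact
  let ?e = "a \<otimes>\<^bsub>M\<^esub> inv\<^bsub>M\<^esub> u"
  have c: "u \<in> carrier M" "inv\<^bsub>M\<^esub> u \<in> carrier M" using u by auto
  have "\<pi> ?e = \<pi> (u \<otimes>\<^bsub>M\<^esub> inv\<^bsub>M\<^esub> u)" using mon_homD(2)[OF \<pi>] a c eq by simp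
  then have "\<pi> ?e = \<one>\<^bsub>Q\<^esub>" using u mon_homD(3)[OF \<pi>] by simp
  then have "?e \<otimes>\<^bsub>M\<^esub> ?e = ?e" using pure a c by simp
  moreover have "a = ?e \<otimes>\<^bsub>M\<^esub> u" using a c u by (simp add: m_assoc)
  ultimately show ?thesis using a c by blast
qed

lemma inj_on_idem_pure_Units:
  assumes N: "group N" and M: "monoid M" and i: "i \<in> mon_hom N M" "inj_on i (carrier N)"
    "i ` carrier N \<subseteq> Units M"
    and \<pi>: "\<pi> \<in> mon_hom M Q"
    and pure: "\<And>x. x \<in> carrier M \<Longrightarrow> \<pi> x = \<one>\<^bsub>Q\<^esub> \<longleftrightarrow> x \<otimes>\<^bsub>M\<^esub> x = x"
  shows "inj_on (\<pi> \<circ> i) (carrier N)"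
proof (rule inj_onI)
  interpret N: group N by fact
  interpret M: monoid M by fact
  fix n m assume nm: "n \<in> carrier N" "m \<in> carrier N" "(\<pi> \<circ> i) n = (\<pi> \<circ> i) m"
  have u: "i n \<in> Units M" "i m \<in> Units M" using i(3) nm by auto
  obtain e where e: "e \<in> carrier M" "e \<otimes>\<^bsub>M\<^esub> e = e" "i n = e \<otimes>\<^bsub>M\<^esub> i m"
    using idem_pure_unit_factor[OF M \<pi> pure _ u(2), of "i n"] u nm(3) by auto
  have "e = i n \<otimes>\<^bsub>M\<^esub> inv\<^bsub>M\<^esub> (i m)" 
    unfolding e(3) using e(1) u(2) M.Units_closed[OF u(2)] by (simp add: M.m_assoc)
  then have "e \<in> Units M" using u by simp
  then have "e = \<one>\<^bsub>M\<^esub>" using M.idem_Units e by simp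
  then have "i n = i m" using e u M.Units_closed[OF u(2)] by simp
  then show "n = m" using i(2) nm by (auto dest: inj_onD)
qed

lemma not_successively_split:
  "\<not> successively P w \<Longrightarrow> \<exists>u x y v. w = u @ x # y # v \<and> \<not> P x y"
proof (induction w)
  case (Cons x w)
  show ?case
  proof (cases "successively P w")
    case True
    with Cons.prems obtain y v where "w = y # v" "\<not> P x y" by (cases w) auto
    then show ?thesis by (intro exI[of _ "[]"]) auto
  next
    case False
    with Cons.IH show ?thesis by (metis append_Cons)
  qed
qed simp

lemma Inv_minv:
  assumes "w \<in> words X"
  shows "minv (Inv X R) (inv_cong X R `` {w}) = inv_cong X R `` {word_inv w}"
proof -
  interpret I: inverse_monoid "Inv X R" by (rule Inv_inverse_monoid)
  show ?thesis
    using assms inv_cong.regular[of w X R] inv_cong.regular[of "word_inv w" X R]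
    by (intro I.minv_unique) (simp_all add: Inv_mult Inv_eq_iff Inv_carrier quotientI)
qed

lemma words_map: "w \<in> words Y \<Longrightarrow> g ` Y \<subseteq> X \<Longrightarrow> map (apfst g) w \<in> words X"
  by (induction w) auto

lemma Inv_word_eval:
  assumes g: "g ` Y \<subseteq> X" and w: "w \<in> words Y"
  shows "word_eval (Inv X R) (\<lambda>x. inv_cong X R `` {[(g x, True)]}) w =
    inv_cong X R `` {map (apfst g) w}"
  using w
proof (induction w)
  case (Cons p w)
  obtain x b where p: "p = (x, b)" "x \<in> Y" using Cons.prems by (cases p) auto
  then have x: "g x \<in> X" "map (apfst g) w \<in> words X" using g Cons.prems words_map[of w Y g X] by auto
  show ?case
    using Cons p x Inv_mult[of "[(g x, b)]" X _ R] Inv_minv[of "[(g x, True)]" X R] by (cases b) simp_all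
qed (simp add: Inv_one)

theorem E_unitary_amalgam:
  fixes M1 :: "('a, 'm) monoid_scheme" and M2 :: "('b, 'n) monoid_scheme"
    and N :: "('c, 'k) monoid_scheme"
  assumes M1: "E_unitary M1" and M2: "E_unitary M2" and N: "inverse_monoid N"
    and i1: "i1 \<in> mon_hom N M1" "inj_on i1 (carrier N)"
    and i2: "i2 \<in> mon_hom N M2" "inj_on i2 (carrier N)"
    and U: "i1 ` carrier N \<subseteq> Units M1" "i2 ` carrier N \<subseteq> Units M2"
  shows "E_unitary (amalgam M1 M2 N i1 i2)"
proof -
  interpret M1: E_unitary M1 by fact
  interpret M2: E_unitary M2 by fact
  have groupN: "group N" by (rule group_if_embeds_in_Units[OF N M1.monoid_axioms i1 U(1)])
  interpret N: group N by fact
  define M where "M = amalgam M1 M2 N i1 i2"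
  define ev where "ev = amalgam_gen M1 M2 N i1 i2"
  define L where "L = carrier M1 <+> carrier M2"
  note po = amalgam_pushout[OF M1.inverse_monoid_axioms M2.inverse_monoid_axioms i1(1) i2(1),
      folded M_def ev_def]
  interpret M: inverse_monoid M by (rule po(1))
  note \<alpha> = mon_homD[OF po(2)] and \<beta> = mon_homD[OF po(3)]
  have ev_closed: "ev x \<in> carrier M" if "x \<in> L" for x
    using that \<alpha>(1) \<beta>(1) by (auto simp: L_def)
  have prod_closed: "prod_letters M ev w \<in> carrier M" if "set w \<subseteq> L" for w
    using that ev_closed by (induction w) auto
  have spanned: "\<exists>w. set w \<subseteq> L \<and> A = prod_letters M ev w" if A: "A \<in> carrier M" for A
  proof -
    define R where "R = mult_table M1 Inl \<union> mult_table M2 Inr \<union>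
        {([(Inl (i1 n), True)], [(Inr (i2 n), True)]) | n. n \<in> carrier N}"
    have MR: "M = Inv L R" by (simp add: M_def amalgam_def L_def R_def)
    have ev: "ev = (\<lambda>x. inv_cong L R `` {[(id x, True)]})"
      by (simp add: ev_def amalgam_gen_def L_def R_def fun_eq_iff)
    obtain u where u: "u \<in> words L" "A = inv_cong L R `` {u}"
      using A unfolding MR Inv_carrier by (auto elim: quotientE)
    have "A = word_eval M ev u"
      using Inv_word_eval[of id L L u R] u unfolding MR ev by simp
    moreover have "\<exists>w. set w \<subseteq> L \<and> word_eval M ev u = prod_letters M ev w"
      using u(1)
    proof (induction u)
      case (Cons p u)
      then obtain w where w: "set w \<subseteq> L" "word_eval M ev u = prod_letters M ev w" by auto
      have "fst p \<in> L" using Cons.prems by simp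
      then have "\<exists>y\<in>L. (if snd p then ev (fst p) else minv M (ev (fst p))) = ev y"
      proof (cases "fst p")
        case (Inl a)
        then have "a \<in> carrier M1" using \<open>fst p \<in> L\<close> by (auto simp: L_def)
        then have "Inl (minv M1 a) \<in> L" "minv M (ev (Inl a)) = ev (Inl (minv M1 a))"
          using mon_hom_minv[OF M1.inverse_monoid_axioms po(1) po(2)] M1.minv_props(1)
          by (auto simp: L_def)
        then show ?thesis using Inl \<open>fst p \<in> L\<close> by auto
      next
        case (Inr a)
        then have "a \<in> carrier M2" using \<open>fst p \<in> L\<close> by (auto simp: L_def)
        then have "Inr (minv M2 a) \<in> L" "minv M (ev (Inr a)) = ev (Inr (minv M2 a))"
          using mon_hom_minv[OF M2.inverse_monoid_axioms po(1) po(3)] M2.minv_props(1)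
          by (auto simp: L_def)
        then show ?thesis using Inr \<open>fst p \<in> L\<close> by auto
      qed
      then obtain y where "y \<in> L" "(if snd p then ev (fst p) else minv M (ev (fst p))) = ev y" by blast
      then have "set (y # w) \<subseteq> L" "word_eval M ev (p # u) = prod_letters M ev (y # w)"
        using w by simp_all
      then show ?case by blast
    next
      case Nil
      have "set [] \<subseteq> L" "word_eval M ev [] = prod_letters M ev []" by simp_all
      then show ?case by blast
    qed
    ultimately show ?thesis by simp
  qed
  have merge: "\<exists>z\<in>L. ev x \<otimes>\<^bsub>M\<^esub> ev y = ev z" if xy: "x \<in> L" "y \<in> L" "isl x = isl y" for x y
  proof (cases x)
    case (Inl a)
    then obtain b where "y = Inl b" using xy by (cases y) auto
    then show ?thesis using xy Inl \<alpha>(2)[of a b]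
      by (intro bexI[of _ "Inl (a \<otimes>\<^bsub>M1\<^esub> b)"]) (auto simp: L_def)
  next
    case (Inr a)
    then obtain b where "y = Inr b" using xy by (cases y) auto
    then show ?thesis using xy Inr \<beta>(2)[of a b]
      by (intro bexI[of _ "Inr (a \<otimes>\<^bsub>M2\<^esub> b)"]) (auto simp: L_def)
  qed
  define k where "k n = ev (Inl (i1 n))" for n
  have k: "\<exists>x\<in>L. ev x = k n \<and> isl x = isl y" if n: "n \<in> carrier N" for n and y :: "'a + 'b"
    using po(4)[OF n] mon_homD(1)[OF i1(1) n] mon_homD(1)[OF i2(1) n]
    by (intro bexI[of _ "if isl y then Inl (i1 n) else Inr (i2 n)"]) (auto simp: k_def L_def)
  have absorb: "\<exists>z\<in>L. k n \<otimes>\<^bsub>M\<^esub> ev y = ev z" "\<exists>z\<in>L. ev y \<otimes>\<^bsub>M\<^esub> k n = ev z"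
    if ny: "n \<in> carrier N" "y \<in> L" for n y
  proof -
    obtain x where "x \<in> L" "ev x = k n" "isl x = isl y" using k[OF ny(1)] by blast
    then show "\<exists>z\<in>L. k n \<otimes>\<^bsub>M\<^esub> ev y = ev z" "\<exists>z\<in>L. ev y \<otimes>\<^bsub>M\<^esub> k n = ev z"
      using merge[of x y] merge[of y x] ny(2) by simp_all
  qed
  obtain Q1 :: "'a set monoid" and \<pi>1 where \<pi>1: "group Q1" "\<pi>1 \<in> mon_hom M1 Q1"
    "\<And>x. x \<in> carrier M1 \<Longrightarrow> \<pi>1 x = \<one>\<^bsub>Q1\<^esub> \<longleftrightarrow> x \<otimes>\<^bsub>M1\<^esub> x = x"
    using E_unitary_idem_pure_hom[OF M1] by metis
  obtain Q2 :: "'b set monoid" and \<pi>2 where \<pi>2: "group Q2" "\<pi>2 \<in> mon_hom M2 Q2"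
    "\<And>x. x \<in> carrier M2 \<Longrightarrow> \<pi>2 x = \<one>\<^bsub>Q2\<^esub> \<longleftrightarrow> x \<otimes>\<^bsub>M2\<^esub> x = x"
    using E_unitary_idem_pure_hom[OF M2] by metis
  note f1 = mon_hom_comp[OF i1(1) \<pi>1(2)] and f2 = mon_hom_comp[OF i2(1) \<pi>2(2)]
  have inj1: "inj_on (\<pi>1 \<circ> i1) (carrier N)"
    by (rule inj_on_idem_pure_Units[OF groupN M1.monoid_axioms i1 U(1) \<pi>1(2,3)])
  have inj2: "inj_on (\<pi>2 \<circ> i2) (carrier N)"
    by (rule inj_on_idem_pure_Units[OF groupN M2.monoid_axioms i2 U(2) \<pi>2(2,3)])
  obtain T :: "('c \<times> ('a set + 'b set) list \<Rightarrow> 'c \<times> ('a set + 'b set) list) monoid" and p q where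
    T: "group T" and p: "p \<in> mon_hom Q1 T" and q: "q \<in> mon_hom Q2 T"
    and pq: "\<And>n. n \<in> carrier N \<Longrightarrow> p ((\<pi>1 \<circ> i1) n) = q ((\<pi>2 \<circ> i2) n)"
    and faithful: "\<And>n. n \<in> carrier N \<Longrightarrow> p ((\<pi>1 \<circ> i1) n) = \<one>\<^bsub>T\<^esub> \<Longrightarrow> n = \<one>\<^bsub>N\<^esub>"
    and normal_form: "\<And>w. w \<noteq> [] \<Longrightarrow> set w \<subseteq> (carrier Q1 - (\<pi>1 \<circ> i1) ` carrier N) <+> (carrier Q2 - (\<pi>2 \<circ> i2) ` carrier N) \<Longrightarrow>
      successively (\<lambda>x y. isl x \<noteq> isl y) w \<Longrightarrow> prod_letters T (case_sum p q) w \<noteq> \<one>\<^bsub>T\<^esub>"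
    by (rule group_amalgam_normal_form[OF \<pi>1(1) \<pi>2(1) groupN f1 inj1 f2 inj2], rule that)
  have "\<exists>h \<in> mon_hom M T. (\<forall>a\<in>carrier M1. h (ev (Inl a)) = (p \<circ> \<pi>1) a) \<and>
      (\<forall>b\<in>carrier M2. h (ev (Inr b)) = (q \<circ> \<pi>2) b)"
    using po(5)[OF group_is_inverse_monoid[OF T] mon_hom_comp[OF \<pi>1(2) p] mon_hom_comp[OF \<pi>2(2) q]] pq
    by fastforce
  then obtain h where h: "h \<in> mon_hom M T" "\<And>a. a \<in> carrier M1 \<Longrightarrow> h (ev (Inl a)) = p (\<pi>1 a)"
      "\<And>b. b \<in> carrier M2 \<Longrightarrow> h (ev (Inr b)) = q (\<pi>2 b)" by auto
  interpret T: group T by fact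
  define bad where "bad x \<longleftrightarrow> (\<exists>n\<in>carrier N. \<exists>e. e \<in> carrier M \<and> e \<otimes>\<^bsub>M\<^esub> e = e \<and> ev x = e \<otimes>\<^bsub>M\<^esub> k n)" for x
  have bad1: "bad (Inl a)" if a: "a \<in> carrier M1" "\<pi>1 a \<in> (\<pi>1 \<circ> i1) ` carrier N" for a
  proof -
    obtain n where n: "n \<in> carrier N" "\<pi>1 a = \<pi>1 (i1 n)" using a by auto
    then obtain e where "e \<in> carrier M1" "e \<otimes>\<^bsub>M1\<^esub> e = e" "a = e \<otimes>\<^bsub>M1\<^esub> i1 n"
      using idem_pure_unit_factor[OF M1.monoid_axioms \<pi>1(2,3) a(1), of "i1 n"] U(1) by blast
    then show ?thesis unfolding bad_def k_def
      using n mon_homD(1)[OF i1(1)] \<alpha>(1) \<alpha>(2)[of e e] \<alpha>(2)[of e "i1 n"]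
      by (intro bexI[of _ n] exI[of _ "ev (Inl e)"]) auto
  qed
  have bad2: "bad (Inr a)" if a: "a \<in> carrier M2" "\<pi>2 a \<in> (\<pi>2 \<circ> i2) ` carrier N" for a
  proof -
    obtain n where n: "n \<in> carrier N" "\<pi>2 a = \<pi>2 (i2 n)" using a by auto
    then obtain e where "e \<in> carrier M2" "e \<otimes>\<^bsub>M2\<^esub> e = e" "a = e \<otimes>\<^bsub>M2\<^esub> i2 n"
      using idem_pure_unit_factor[OF M2.monoid_axioms \<pi>2(2,3) a(1), of "i2 n"] U(2) by blast
    then show ?thesis unfolding bad_def k_def po(4)[OF n(1)]
      using n mon_homD(1)[OF i2(1)] \<beta>(1) \<beta>(2)[of e e] \<beta>(2)[of e "i2 n"] po(4)
      by (intro bexI[of _ n] exI[of _ "ev (Inr e)"]) auto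
  qed
  have h_idem: "h e = \<one>\<^bsub>T\<^esub>" if "e \<in> carrier M" "e \<otimes>\<^bsub>M\<^esub> e = e" for e
    by (rule mon_hom_idem_group[OF h(1) T that])
  have k_closed: "k n \<in> carrier M" if "n \<in> carrier N" for n
    using that \<alpha>(1) mon_homD(1)[OF i1(1)] by (simp add: k_def)
  let ?E = "prod_letters M ev"
  have pure: "?E w \<otimes>\<^bsub>M\<^esub> ?E w = ?E w" if "set w \<subseteq> L" "h (?E w) = \<one>\<^bsub>T\<^esub>" for w
    using that
  proof (induction "length w" arbitrary: w rule: less_induct)
    case less
    have app: "?E (u @ v) = ?E u \<otimes>\<^bsub>M\<^esub> ?E v" if "set u \<subseteq> L" "set v \<subseteq> L" for u v
      using that ev_closed by (intro M.prod_letters_append) auto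
    consider "w = []" | (bad) x where "x \<in> set w" "bad x"
      | (unreduced) "\<not> successively (\<lambda>x y. isl x \<noteq> isl y) w"
      | (reduced) "w \<noteq> []" "\<And>x. x \<in> set w \<Longrightarrow> \<not> bad x" "successively (\<lambda>x y. isl x \<noteq> isl y) w"
      by blast
    then show ?case
    proof cases
      case 1
      then show ?thesis by simp
    next
      case unreduced
      obtain u x y v where w: "w = u @ x # y # v" "isl x = isl y"
        using not_successively_split[OF unreduced] by auto
      then have c: "set u \<subseteq> L" "x \<in> L" "y \<in> L" "set v \<subseteq> L" using less.prems(1) by auto
      obtain z where z: "z \<in> L" "ev x \<otimes>\<^bsub>M\<^esub> ev y = ev z" using merge[OF c(2,3) w(2)] by auto
      have eq: "?E w = ?E (u @ z # v)"
        using c z(1) app[of u "x # y # v"] app[of u "z # v"] ev_closed[OF c(2)] ev_closed[OF c(3)] prod_closed[OF c(4)]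
        by (simp add: w M.m_assoc flip: z(2))
      show ?thesis unfolding eq
        by (rule less.hyps) (use c z w less.prems eq in auto)
    next
      case bad
      obtain u v where w: "w = u @ x # v" using bad(1) by (auto simp: in_set_conv_decomp)
      then have c: "set u \<subseteq> L" "x \<in> L" "set v \<subseteq> L" using less.prems(1) by auto
      obtain n e where n: "n \<in> carrier N" and e: "e \<in> carrier M" "e \<otimes>\<^bsub>M\<^esub> e = e" "ev x = e \<otimes>\<^bsub>M\<^esub> k n"
        using bad(2) unfolding bad_def by blast
      define e' where "e' = ?E u \<otimes>\<^bsub>M\<^esub> e \<otimes>\<^bsub>M\<^esub> minv M (?E u)"
      have e': "?E u \<otimes>\<^bsub>M\<^esub> e = e' \<otimes>\<^bsub>M\<^esub> ?E u" "e' \<in> carrier M" "e' \<otimes>\<^bsub>M\<^esub> e' = e'"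
        using M.idem_conj[OF prod_closed[OF c(1)] e(1,2)] unfolding e'_def by auto
      define y where "y = ?E u \<otimes>\<^bsub>M\<^esub> (k n \<otimes>\<^bsub>M\<^esub> ?E v)"
      have y: "y \<in> carrier M" unfolding y_def using c k_closed[OF n] prod_closed by simp
      have "?E w = ?E u \<otimes>\<^bsub>M\<^esub> (e \<otimes>\<^bsub>M\<^esub> k n \<otimes>\<^bsub>M\<^esub> ?E v)" using app[of u "x # v"] c e(3) by (simp add: w)
      also have "\<dots> = (?E u \<otimes>\<^bsub>M\<^esub> e) \<otimes>\<^bsub>M\<^esub> (k n \<otimes>\<^bsub>M\<^esub> ?E v)"
        using prod_closed[OF c(1)] prod_closed[OF c(3)] k_closed[OF n] e(1) by (simp add: M.m_assoc)
      also have "\<dots> = e' \<otimes>\<^bsub>M\<^esub> y"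
        unfolding e'(1) y_def
        using prod_closed[OF c(1)] prod_closed[OF c(3)] k_closed[OF n] e'(2) by (simp add: M.m_assoc)
      finally have eq: "?E w = e' \<otimes>\<^bsub>M\<^esub> y" .
      then have hy: "h y = \<one>\<^bsub>T\<^esub>"
        using less.prems(2) mon_homD(2)[OF h(1) e'(2) y] h_idem[OF e'(2,3)] mon_homD(1)[OF h(1) y] by simp
      have "y \<otimes>\<^bsub>M\<^esub> y = y"
      proof -
        consider "u = []" "v = []" | z v' where "v = z # v'" | z u' where "u = u' @ [z]" "v = []"
          by (metis neq_Nil_conv rev_exhaust)
        then show ?thesis
        proof cases
          case 1
          then have "h (k n) = \<one>\<^bsub>T\<^esub>" using hy k_closed[OF n] by (simp add: y_def)
          then have "n = \<one>\<^bsub>N\<^esub>" using faithful n h(2)[of "i1 n"] mon_homD(1)[OF i1(1) n] by (simp add: k_def)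
          then show ?thesis using 1 \<alpha>(3) mon_homD(3)[OF i1(1)] by (simp add: y_def k_def)
        next
          case 2
          then have z: "z \<in> L" "set v' \<subseteq> L" using c by auto
          obtain z' where z': "z' \<in> L" "k n \<otimes>\<^bsub>M\<^esub> ev z = ev z'" using absorb(1)[OF n z(1)] by auto
          have y': "y = ?E (u @ z' # v')"
            using app[of u "z' # v'"] c(1) z z'(1) k_closed[OF n] ev_closed[OF z(1)] prod_closed[OF z(2)]
            by (simp add: y_def 2 flip: z'(2) M.m_assoc)
          show ?thesis unfolding y'
            by (rule less.hyps) (use c z z' w 2 hy y' in auto)
        next
          case 3
          then have z: "z \<in> L" "set u' \<subseteq> L" using c by auto
          obtain z' where z': "z' \<in> L" "ev z \<otimes>\<^bsub>M\<^esub> k n = ev z'" using absorb(2)[OF n z(1)] by auto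
          have y': "y = ?E (u' @ [z'])"
            using app[of u' "[z']"] app[of u' "[z]"] z z'(1) k_closed[OF n] ev_closed[OF z(1)] ev_closed[OF z'(1)]
              prod_closed[OF z(2)] by (simp add: y_def 3 M.m_assoc z'(2))
          show ?thesis unfolding y'
            by (rule less.hyps) (use c z z' w 3 hy y' in auto)
        qed
      qed
      then show ?thesis unfolding eq using M.idem_prod[OF e'(2,3) y] by simp
    next
      case reduced
      define \<pi> where "\<pi> = map_sum \<pi>1 \<pi>2"
      have L: "isl (\<pi> x) = isl x \<and> h (ev x) = case_sum p q (\<pi> x) \<and>
          \<pi> x \<in> (carrier Q1 - (\<pi>1 \<circ> i1) ` carrier N) <+> (carrier Q2 - (\<pi>2 \<circ> i2) ` carrier N)"
        if x: "x \<in> set w" for x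
        using reduced(2)[OF x] subsetD[OF less.prems(1) x] bad1 bad2 h(2,3) mon_homD(1)[OF \<pi>1(2)] mon_homD(1)[OF \<pi>2(2)]
        by (cases x) (auto simp: \<pi>_def L_def)
      have "h (?E w) = prod_letters T (h \<circ> ev) w"
        using mon_hom_prod_letters[OF h(1) M.monoid_axioms, of ev w] ev_closed less.prems(1) by auto
      also have "\<dots> = prod_letters T (case_sum p q) (map \<pi> w)"
        unfolding prod_letters_def foldr_map using L by (intro foldr_cong) auto
      finally have "h (?E w) = prod_letters T (case_sum p q) (map \<pi> w)" .
      moreover have "prod_letters T (case_sum p q) (map \<pi> w) \<noteq> \<one>\<^bsub>T\<^esub>"
        using reduced(1,3) L
        by (intro normal_form) (auto simp: successively_map cong: successively_cong)
      ultimately show ?thesis using less.prems(2) by simp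
    qed
  qed
  show ?thesis
    unfolding M_def[symmetric]
  proof (rule E_unitaryI_idem_pure_hom[OF po(1) T h(1)])
    fix A assume "A \<in> carrier M" "h A = \<one>\<^bsub>T\<^esub>"
    then show "A \<otimes>\<^bsub>M\<^esub> A = A" using spanned[of A] pure by auto
  qed
qed

section \<open>Finite special presentations\<close>

lemma mon_hom_word_eval:
  assumes G: "inverse_monoid G" and H: "inverse_monoid H" and h: "h \<in> mon_hom G H"
    and f: "f ` X \<subseteq> carrier G" and w: "w \<in> words X"
  shows "h (word_eval G f w) = word_eval H (h \<circ> f) w"
proof -
  interpret G: inverse_monoid G by fact
  show ?thesis
    using w
  proof (induction w)
    case (Cons p w)
    then have "fst p \<in> X" "w \<in> words X" "f (fst p) \<in> carrier G" using f by auto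
    then show ?case
      using Cons.IH G.word_eval_closed[OF f, of w] G.minv_props(1)[of "f (fst p)"] mon_homD(2)[OF h]
        mon_hom_minv[OF G H h, of "f (fst p)"] by simp
  qed (use mon_homD(3)[OF h] in simp)
qed

lemma word_eval_map: "word_eval G f (map (apfst g) w) = word_eval G (f \<circ> g) w"
  by (induction w) simp_all

lemma word_eval_cong:
  "w \<in> words X \<Longrightarrow> (\<And>x. x \<in> X \<Longrightarrow> f x = g x) \<Longrightarrow> word_eval G f w = word_eval G g w"
  by (induction w) simp_all

lemma Inv_hom_word:
  assumes T: "inverse_monoid T" and h: "h \<in> mon_hom (Inv X R) T"
    and eq: "\<And>x. x \<in> X \<Longrightarrow> h (inv_cong X R `` {[(x, True)]}) = f x" and w: "w \<in> words X"
  shows "h (inv_cong X R `` {w}) = word_eval T f w"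
proof -
  let ?g = "\<lambda>x. inv_cong X R `` {[(id x, True)]}"
  have "h (inv_cong X R `` {w}) = h (word_eval (Inv X R) ?g w)"
    using Inv_word_eval[of id X X w R] w by simp
  also have "\<dots> = word_eval T (h \<circ> ?g) w"
    by (rule mon_hom_word_eval[OF Inv_inverse_monoid T h _ w]) (auto simp: Inv_carrier intro!: quotientI)
  also have "\<dots> = word_eval T f w" by (rule word_eval_cong[OF w]) (simp add: eq)
  finally show ?thesis .
qed

lemma Inv_relator:
  assumes "(w, []) \<in> R" "w \<in> words X"
  shows "inv_cong X R `` {w} = \<one>\<^bsub>Inv X R\<^esub>"
  using inv_cong.rel[OF assms] assms(2) by (simp add: Inv_one Inv_eq_iff)

lemma mon_hom_eq_on_generators:
  assumes N: "inverse_monoid N" and P: "inverse_monoid P"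
    and f: "f \<in> mon_hom N P" and g: "g \<in> mon_hom N P"
    and gen: "A \<subseteq> carrier N" "\<Inter>{H. inverse_submonoid H N \<and> A \<subseteq> H} = carrier N"
    and eq: "\<And>a. a \<in> A \<Longrightarrow> f a = g a" and n: "n \<in> carrier N"
  shows "f n = g n"
proof -
  interpret N: inverse_monoid N by fact
  let ?H = "{x \<in> carrier N. f x = g x}"
  have "inverse_submonoid ?H N"
    unfolding inverse_submonoid_def
    using mon_homD[OF f] mon_homD[OF g] mon_hom_minv[OF N P f] mon_hom_minv[OF N P g] N.minv_props(1)
    by auto
  then have "carrier N \<subseteq> ?H" using gen eq by blast
  then show ?thesis using n by blast
qed

lemma is_iso_mon_hom:
  assumes G: "monoid G" and H: "monoid H" and iso: "G \<cong> H"
  obtains f g where "f \<in> mon_hom G H" "g \<in> mon_hom H G"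
    "\<And>x. x \<in> carrier G \<Longrightarrow> g (f x) = x" "\<And>y. y \<in> carrier H \<Longrightarrow> f (g y) = y"
proof -
  interpret G: monoid G by fact
  interpret H: monoid H by fact
  obtain f where f: "f \<in> hom G H" "bij_betw f (carrier G) (carrier H)"
    using iso by (auto simp: is_iso_def iso_def)
  let ?g = "inv_into (carrier G) f"
  have g: "?g y \<in> carrier G" "f (?g y) = y" if "y \<in> carrier H" for y
    using that f(2) by (auto simp: bij_betw_def inv_into_into f_inv_into_f)
  have gf: "?g (f x) = x" if "x \<in> carrier G" for x
    using that f(2) by (simp add: bij_betw_def)
  have fc: "f x \<in> carrier H" if "x \<in> carrier G" for x using that f(1) by (auto simp: hom_def)
  have fm: "f (x \<otimes>\<^bsub>G\<^esub> y) = f x \<otimes>\<^bsub>H\<^esub> f y" if "x \<in> carrier G" "y \<in> carrier G" for x y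
    using that f(1) by (auto simp: hom_def)
  have "f \<one>\<^bsub>G\<^esub> = f \<one>\<^bsub>G\<^esub> \<otimes>\<^bsub>H\<^esub> f (?g \<one>\<^bsub>H\<^esub>)" using g[OF H.one_closed] fc[OF G.one_closed] by simp
  also have "\<dots> = f (?g \<one>\<^bsub>H\<^esub>)" using fm[OF G.one_closed g(1)[OF H.one_closed]] g[OF H.one_closed] by simp
  finally have f1: "f \<one>\<^bsub>G\<^esub> = \<one>\<^bsub>H\<^esub>" using g[OF H.one_closed] by simp
  have fh: "f \<in> mon_hom G H" using f(1) f1 by (simp add: mon_hom_def)
  have gm: "?g (x \<otimes>\<^bsub>H\<^esub> y) = ?g x \<otimes>\<^bsub>G\<^esub> ?g y" if "x \<in> carrier H" "y \<in> carrier H" for x y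
  proof -
    have "f (?g x \<otimes>\<^bsub>G\<^esub> ?g y) = x \<otimes>\<^bsub>H\<^esub> y" using that g fm by simp
    then show ?thesis using gf[of "?g x \<otimes>\<^bsub>G\<^esub> ?g y"] that g by simp
  qed
  have "?g \<one>\<^bsub>H\<^esub> = \<one>\<^bsub>G\<^esub>" using gf[OF G.one_closed] f1 by simp
  then have "?g \<in> mon_hom H G" by (intro mon_homI g(1) gm)
  then show thesis using that[OF fh] gf g(2) by blast
qed

lemma is_isoI_mon_hom:
  assumes "f \<in> mon_hom G H" "g \<in> mon_hom H G"
    "\<And>x. x \<in> carrier G \<Longrightarrow> g (f x) = x" "\<And>y. y \<in> carrier H \<Longrightarrow> f (g y) = y"
  shows "G \<cong> H"
proof -
  have "bij_betw f (carrier G) (carrier H)"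
    using assms(3,4) mon_homD(1)[OF assms(1)] mon_homD(1)[OF assms(2)]
    by (intro bij_betw_byWitness[where f' = g]) auto
  then show ?thesis using assms(1) by (auto simp: is_iso_def iso_def mon_hom_def)
qed

theorem amalgam_finite_special_presentation:
  fixes M1 :: "('a, 'm) monoid_scheme" and M2 :: "('b, 'n) monoid_scheme"
    and N :: "('c, 'k) monoid_scheme"
  assumes M1: "inverse_monoid M1" and M2: "inverse_monoid M2" and N: "inverse_monoid N"
    and i1: "i1 \<in> mon_hom N M1" and i2: "i2 \<in> mon_hom N M2"
    and U: "i2 ` carrier N \<subseteq> Units M2"
    and pres: "has_finite_special_presentation M1" "has_finite_special_presentation M2"
    and fg: "finitely_generated N"
  shows "has_finite_special_presentation (amalgam M1 M2 N i1 i2)"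
proof -
  interpret M1: inverse_monoid M1 by fact
  interpret M2: inverse_monoid M2 by fact
  interpret N: inverse_monoid N by fact
  obtain X1 :: "nat set" and R1 where P1: "finite X1" "finite R1" "R1 \<subseteq> words X1 \<times> {[]}" "M1 \<cong> Inv X1 R1"
    using pres(1) unfolding has_finite_special_presentation_def by blast
  obtain X2 :: "nat set" and R2 where P2: "finite X2" "finite R2" "R2 \<subseteq> words X2 \<times> {[]}" "M2 \<cong> Inv X2 R2"
    using pres(2) unfolding has_finite_special_presentation_def by blast
  obtain A where A: "finite A" "A \<subseteq> carrier N" "\<Inter>{H. inverse_submonoid H N \<and> A \<subseteq> H} = carrier N"
    using fg unfolding finitely_generated_def by blast
  note I1 = Inv_inverse_monoid[of X1 R1] and I2 = Inv_inverse_monoid[of X2 R2]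
  obtain \<phi>1 \<psi>1 where \<phi>1: "\<phi>1 \<in> mon_hom M1 (Inv X1 R1)" "\<psi>1 \<in> mon_hom (Inv X1 R1) M1"
    "\<And>x. x \<in> carrier M1 \<Longrightarrow> \<psi>1 (\<phi>1 x) = x" "\<And>y. y \<in> carrier (Inv X1 R1) \<Longrightarrow> \<phi>1 (\<psi>1 y) = y"
    using is_iso_mon_hom[OF M1.monoid_axioms inverse_monoid.axioms(1)[OF I1] P1(4)] by metis
  obtain \<phi>2 \<psi>2 where \<phi>2: "\<phi>2 \<in> mon_hom M2 (Inv X2 R2)" "\<psi>2 \<in> mon_hom (Inv X2 R2) M2"
    "\<And>x. x \<in> carrier M2 \<Longrightarrow> \<psi>2 (\<phi>2 x) = x" "\<And>y. y \<in> carrier (Inv X2 R2) \<Longrightarrow> \<phi>2 (\<psi>2 y) = y"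
    using is_iso_mon_hom[OF M2.monoid_axioms inverse_monoid.axioms(1)[OF I2] P2(4)] by metis
  have "\<exists>u. u \<in> words X1 \<and> \<phi>1 (i1 a) = inv_cong X1 R1 `` {u}" if "a \<in> A" for a
    using mon_homD(1)[OF \<phi>1(1) mon_homD(1)[OF i1]] that A(2)
    unfolding Inv_carrier by (meson quotientE subsetD)
  then obtain u where u: "\<And>a. a \<in> A \<Longrightarrow> u a \<in> words X1" "\<And>a. a \<in> A \<Longrightarrow> \<phi>1 (i1 a) = inv_cong X1 R1 `` {u a}"
    by metis
  have "\<exists>u. u \<in> words X2 \<and> \<phi>2 (i2 a) = inv_cong X2 R2 `` {u}" if "a \<in> A" for a
    using mon_homD(1)[OF \<phi>2(1) mon_homD(1)[OF i2]] that A(2)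
    unfolding Inv_carrier by (meson quotientE subsetD)
  then obtain v where v: "\<And>a. a \<in> A \<Longrightarrow> v a \<in> words X2" "\<And>a. a \<in> A \<Longrightarrow> \<phi>2 (i2 a) = inv_cong X2 R2 `` {v a}"
    by metis

  define g1 where "g1 = (\<lambda>x::nat. 2 * x)"
  define g2 where "g2 = (\<lambda>x::nat. 2 * x + 1)"
  define X where "X = g1 ` X1 \<union> g2 ` X2"
  let ?m1 = "map (apfst g1) :: nat word \<Rightarrow> nat word" and ?m2 = "map (apfst g2) :: nat word \<Rightarrow> nat word"
  define R where "R = map_prod ?m1 id ` R1 \<union> map_prod ?m2 id ` R2 \<union>
    (\<lambda>a. (?m1 (u a) @ word_inv (?m2 (v a)), [])) ` A"
  have R_mem: "(w, []) \<in> R1 \<Longrightarrow> (?m1 w, []) \<in> R" "(w, []) \<in> R2 \<Longrightarrow> (?m2 w, []) \<in> R" for w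
    unfolding R_def by (auto intro: rev_image_eqI)
  have g: "g1 ` X1 \<subseteq> X" "g2 ` X2 \<subseteq> X" by (auto simp: X_def)
  have m1: "?m1 w \<in> words X" if "w \<in> words X1" for w using that by (rule words_map[OF _ g(1)])
  have m2: "?m2 w \<in> words X" if "w \<in> words X2" for w using that by (rule words_map[OF _ g(2)])
  have finX: "finite X" "finite R" using P1(1,2) P2(1,2) A(1) by (auto simp: X_def R_def)
  have special: "R \<subseteq> words X \<times> {[]}"
    using P1(3) P2(3) m1 m2 u(1) v(1) by (auto simp: R_def)
  let ?P = "Inv X R" and ?c = "\<lambda>w. inv_cong X R `` {w}"
  interpret P: inverse_monoid ?P by (rule Inv_inverse_monoid)
  have R_one: "?c w = \<one>\<^bsub>?P\<^esub>" if "(w, []) \<in> R" for w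
    by (rule Inv_relator[OF that]) (use that special in auto)
  have c_closed: "?c w \<in> carrier ?P" if "w \<in> words X" for w
    using that by (simp add: Inv_carrier quotientI)

  have ex1: "\<exists>h\<in>mon_hom (Inv X1 R1) ?P. \<forall>x\<in>X1. h (inv_cong X1 R1 `` {[(x, True)]}) = ?c [(g1 x, True)]"
  proof (rule Inv_universal[OF P.inverse_monoid_axioms])
    show "(\<lambda>x. ?c [(g1 x, True)]) ` X1 \<subseteq> carrier ?P" using g(1) c_closed by auto
    fix w w' assume "(w, w') \<in> R1"
    then have w: "w \<in> words X1" "w' = []" "(?m1 w, []) \<in> R" using P1(3) R_mem(1) by auto
    then show "word_eval ?P (\<lambda>x. ?c [(g1 x, True)]) w = word_eval ?P (\<lambda>x. ?c [(g1 x, True)]) w'"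
      using Inv_word_eval[OF g(1) w(1)] R_one[OF w(3)] by simp
  qed
  have ex2: "\<exists>h\<in>mon_hom (Inv X2 R2) ?P. \<forall>x\<in>X2. h (inv_cong X2 R2 `` {[(x, True)]}) = ?c [(g2 x, True)]"
  proof (rule Inv_universal[OF P.inverse_monoid_axioms])
    show "(\<lambda>x. ?c [(g2 x, True)]) ` X2 \<subseteq> carrier ?P" using g(2) c_closed by auto
    fix w w' assume "(w, w') \<in> R2"
    then have w: "w \<in> words X2" "w' = []" "(?m2 w, []) \<in> R" using P2(3) R_mem(2) by auto
    then show "word_eval ?P (\<lambda>x. ?c [(g2 x, True)]) w = word_eval ?P (\<lambda>x. ?c [(g2 x, True)]) w'"
      using Inv_word_eval[OF g(2) w(1)] R_one[OF w(3)] by simp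
  qed
  obtain h1 where h1: "h1 \<in> mon_hom (Inv X1 R1) ?P" "\<And>x. x \<in> X1 \<Longrightarrow> h1 (inv_cong X1 R1 `` {[(x, True)]}) = ?c [(g1 x, True)]"
    using ex1 by blast
  obtain h2 where h2: "h2 \<in> mon_hom (Inv X2 R2) ?P" "\<And>x. x \<in> X2 \<Longrightarrow> h2 (inv_cong X2 R2 `` {[(x, True)]}) = ?c [(g2 x, True)]"
    using ex2 by blast
  have hw1: "h1 (inv_cong X1 R1 `` {w}) = ?c (?m1 w)" if "w \<in> words X1" for w
    by (rule Inv_hom_word[OF P.inverse_monoid_axioms h1 that, THEN HOL.trans])
      (use Inv_word_eval[OF g(1) that] in auto)
  have hw2: "h2 (inv_cong X2 R2 `` {w}) = ?c (?m2 w)" if "w \<in> words X2" for w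
    by (rule Inv_hom_word[OF P.inverse_monoid_axioms h2 that, THEN HOL.trans])
      (use Inv_word_eval[OF g(2) that] in auto)
  note p1 = mon_hom_comp[OF \<phi>1(1) h1(1)] and p2 = mon_hom_comp[OF \<phi>2(1) h2(1)]
  have agree_A: "(h1 \<circ> \<phi>1 \<circ> i1) a = (h2 \<circ> \<phi>2 \<circ> i2) a" if a: "a \<in> A" for a
  proof -
    let ?u = "?c (?m1 (u a))" and ?v = "?c (?m2 (v a))"
    have eq: "(h1 \<circ> \<phi>1 \<circ> i1) a = ?u" "(h2 \<circ> \<phi>2 \<circ> i2) a = ?v"
      using a u v hw1 hw2 by simp_all
    have w: "?m1 (u a) \<in> words X" "?m2 (v a) \<in> words X" using a u(1) v(1) m1 m2 by auto
    have "i2 a \<in> Units M2" using U a A(2) by auto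
    from mon_hom_Units[OF p2 M2.monoid_axioms this] have vU: "?v \<in> Units ?P" using eq(2) by simp
    have "(?m1 (u a) @ word_inv (?m2 (v a)), []) \<in> R" using a by (auto simp: R_def)
    then have "?u \<otimes>\<^bsub>?P\<^esub> minv ?P ?v = \<one>\<^bsub>?P\<^esub>"
      using R_one w by (simp add: Inv_minv Inv_mult)
    then have "?u \<otimes>\<^bsub>?P\<^esub> minv ?P ?v \<otimes>\<^bsub>?P\<^esub> ?v = ?v" using c_closed[OF w(2)] by simp
    then have "?u = ?v"
      using P.minv_Units(1)[OF vU] c_closed[OF w(1)] c_closed[OF w(2)] P.minv_props(1) by (simp add: P.m_assoc)
    then show ?thesis using eq by simp
  qed
  have agree: "(h1 \<circ> \<phi>1) (i1 n) = (h2 \<circ> \<phi>2) (i2 n)" if "n \<in> carrier N" for n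
    using mon_hom_eq_on_generators[OF N P.inverse_monoid_axioms mon_hom_comp[OF i1 p1] mon_hom_comp[OF i2 p2] A(2,3) _ that]
      agree_A by simp

  let ?M = "amalgam M1 M2 N i1 i2"
  define \<alpha> where "\<alpha> a = amalgam_gen M1 M2 N i1 i2 (Inl a)" for a
  define \<beta> where "\<beta> b = amalgam_gen M1 M2 N i1 i2 (Inr b)" for b
  note po = amalgam_pushout[OF M1 M2 i1 i2, folded \<alpha>_def \<beta>_def]
  interpret M: inverse_monoid ?M by (rule po(1))
  have \<alpha>: "\<alpha> \<in> mon_hom M1 ?M" and \<beta>: "\<beta> \<in> mon_hom M2 ?M" using po(2,3) by simp_all
  obtain F where F: "F \<in> mon_hom ?M ?P" "\<forall>a\<in>carrier M1. F (\<alpha> a) = (h1 \<circ> \<phi>1) a"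
    "\<forall>b\<in>carrier M2. F (\<beta> b) = (h2 \<circ> \<phi>2) b"
    by (rule bexE[OF po(5)[OF P.inverse_monoid_axioms p1 p2 agree]], assumption, elim conjE, rule that)
  have F\<alpha>: "F (\<alpha> a) = h1 (\<phi>1 a)" if "a \<in> carrier M1" for a using F(2) that by simp
  have F\<beta>: "F (\<beta> b) = h2 (\<phi>2 b)" if "b \<in> carrier M2" for b using F(3) that by simp

  note k1 = mon_hom_comp[OF \<phi>1(2) \<alpha>] and k2 = mon_hom_comp[OF \<phi>2(2) \<beta>]
  define gen where "gen x = (if even x then (\<alpha> \<circ> \<psi>1) (inv_cong X1 R1 `` {[(x div 2, True)]})
    else (\<beta> \<circ> \<psi>2) (inv_cong X2 R2 `` {[(x div 2, True)]}))" for x :: nat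
  have gen1: "gen (g1 x) = (\<alpha> \<circ> \<psi>1) (inv_cong X1 R1 `` {[(x, True)]})" for x by (simp add: gen_def g1_def)
  have gen2: "gen (g2 x) = (\<beta> \<circ> \<psi>2) (inv_cong X2 R2 `` {[(x, True)]})" for x by (simp add: gen_def g2_def)
  have gen_closed: "gen ` X \<subseteq> carrier ?M"
  proof -
    have "gen (g1 x) \<in> carrier ?M" if "x \<in> X1" for x
      unfolding gen1 by (rule mon_homD(1)[OF k1]) (use that in \<open>simp add: Inv_carrier quotientI\<close>)
    moreover have "gen (g2 x) \<in> carrier ?M" if "x \<in> X2" for x
      unfolding gen2 by (rule mon_homD(1)[OF k2]) (use that in \<open>simp add: Inv_carrier quotientI\<close>)
    ultimately show ?thesis by (auto simp: X_def)
  qed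
  have gw1: "word_eval ?M gen (?m1 w) = \<alpha> (\<psi>1 (inv_cong X1 R1 `` {w}))" if "w \<in> words X1" for w
    using Inv_hom_word[OF po(1) k1 _ that, of "gen \<circ> g1"] gen1 by (simp add: word_eval_map)
  have gw2: "word_eval ?M gen (?m2 w) = \<beta> (\<psi>2 (inv_cong X2 R2 `` {w}))" if "w \<in> words X2" for w
    using Inv_hom_word[OF po(1) k2 _ that, of "gen \<circ> g2"] gen2 by (simp add: word_eval_map)
  have "\<exists>h\<in>mon_hom ?P ?M. \<forall>x\<in>X. h (?c [(x, True)]) = gen x"
  proof (rule Inv_universal[OF po(1) gen_closed])
    fix w w' assume "(w, w') \<in> R"
    then consider (1) z where "(z, []) \<in> R1" "z \<in> words X1" "w = ?m1 z" "w' = []"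
      | (2) z where "(z, []) \<in> R2" "z \<in> words X2" "w = ?m2 z" "w' = []"
      | (3) a where "a \<in> A" "w = ?m1 (u a) @ word_inv (?m2 (v a))" "w' = []"
      unfolding R_def using P1(3) P2(3) by auto
    then show "word_eval ?M gen w = word_eval ?M gen w'"
    proof cases
      case 1
      then have "inv_cong X1 R1 `` {z} = \<one>\<^bsub>Inv X1 R1\<^esub>" by (intro Inv_relator)
      then show ?thesis using 1 gw1[of z] mon_homD(3)[OF k1] by simp
    next
      case 2
      then have "inv_cong X2 R2 `` {z} = \<one>\<^bsub>Inv X2 R2\<^esub>" by (intro Inv_relator)
      then show ?thesis using 2 gw2[of z] mon_homD(3)[OF k2] by simp
    next
      case 3
      then have a: "a \<in> carrier N" and w: "?m1 (u a) \<in> words X" "?m2 (v a) \<in> words X"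
        using A(2) u(1) v(1) m1 m2 by auto
      have "word_eval ?M gen (?m1 (u a)) = \<alpha> (i1 a)"
        using gw1 u 3(1) \<phi>1(3) mon_homD(1)[OF i1 a] by (simp flip: u(2))
      moreover have "word_eval ?M gen (?m2 (v a)) = \<alpha> (i1 a)"
        using gw2 v 3(1) \<phi>2(3) mon_homD(1)[OF i2 a] po(4)[OF a] by (simp flip: v(2))
      moreover have "\<alpha> (i1 a) \<in> Units ?M"
        unfolding po(4)[OF a] using mon_hom_Units[OF \<beta> M2.monoid_axioms] U a by auto
      ultimately show ?thesis
        using 3 w M.word_eval_append[OF gen_closed] M.word_eval_inv[OF gen_closed w(2)] M.minv_Units(2) by simp
    qed
  qed
  then obtain K where K: "K \<in> mon_hom ?P ?M" "\<And>x. x \<in> X \<Longrightarrow> K (?c [(x, True)]) = gen x" by blast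

  have Kw: "K (?c w) = word_eval ?M gen w" if "w \<in> words X" for w
    by (rule Inv_hom_word[OF po(1) K that])
  have KF1: "K (F (\<alpha> a)) = \<alpha> a" if a: "a \<in> carrier M1" for a
  proof -
    obtain w where w: "w \<in> words X1" "\<phi>1 a = inv_cong X1 R1 `` {w}"
      using mon_homD(1)[OF \<phi>1(1) a] unfolding Inv_carrier by (auto elim: quotientE)
    then show ?thesis using F\<alpha>[OF a] hw1 Kw m1 gw1 \<phi>1(3)[OF a] by metis
  qed
  have KF2: "K (F (\<beta> b)) = \<beta> b" if b: "b \<in> carrier M2" for b
  proof -
    obtain w where w: "w \<in> words X2" "\<phi>2 b = inv_cong X2 R2 `` {w}"
      using mon_homD(1)[OF \<phi>2(1) b] unfolding Inv_carrier by (auto elim: quotientE)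
    then show ?thesis using F\<beta>[OF b] hw2 Kw m2 gw2 \<phi>2(3)[OF b] by metis
  qed
  have KF: "K (F x) = x" if x: "x \<in> carrier ?M" for x
  proof -
    have id: "(\<lambda>x. x) \<in> mon_hom ?M ?M" by (rule mon_homI) simp_all
    obtain h where h: "\<forall>h' \<in> mon_hom ?M ?M. (\<forall>a\<in>carrier M1. h' (\<alpha> a) = \<alpha> a) \<and> (\<forall>b\<in>carrier M2. h' (\<beta> b) = \<beta> b) \<longrightarrow>
          (\<forall>x\<in>carrier ?M. h' x = h x)"
      by (rule bexE[OF po(5)[OF po(1) \<alpha> \<beta> po(4)]], assumption, elim conjE, rule that)
    have "x = h x" using bspec[OF h id] x by simp
    moreover have "K (F x) = h x" using bspec[OF h mon_hom_comp[OF F(1) K(1)]] KF1 KF2 x by simp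
    ultimately show ?thesis by simp
  qed
  have FK: "F (K y) = y" if y: "y \<in> carrier ?P" for y
  proof -
    have id: "(\<lambda>x. x) \<in> mon_hom ?P ?P" by (rule mon_homI) simp_all
    have "(F \<circ> K) y = (\<lambda>x. x) y"
    proof (rule Inv_hom_unique[OF P.inverse_monoid_axioms mon_hom_comp[OF K(1) F(1)] id _ y])
      fix x assume "x \<in> X"
      then consider (1) z where "z \<in> X1" "x = g1 z" | (2) z where "z \<in> X2" "x = g2 z" by (auto simp: X_def)
      then show "(F \<circ> K) (?c [(x, True)]) = ?c [(x, True)]"
      proof cases
        case 1
        then have "inv_cong X1 R1 `` {[(z, True)]} \<in> carrier (Inv X1 R1)" by (simp add: Inv_carrier quotientI)
        then show ?thesis
          using 1 K(2)[OF \<open>x \<in> X\<close>] gen1 F\<alpha> \<phi>1(4) h1(2) mon_homD(1)[OF \<phi>1(2)] by simp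
      next
        case 2
        then have "inv_cong X2 R2 `` {[(z, True)]} \<in> carrier (Inv X2 R2)" by (simp add: Inv_carrier quotientI)
        then show ?thesis
          using 2 K(2)[OF \<open>x \<in> X\<close>] gen2 F\<beta> \<phi>2(4) h2(2) mon_homD(1)[OF \<phi>2(2)] by simp
      qed
    qed
    then show ?thesis by simp
  qed
  have "?M \<cong> ?P" by (rule is_isoI_mon_hom[OF F(1) K(1) KF FK])
  then show ?thesis unfolding has_finite_special_presentation_def using finX special by blast
qed

theorem theorem3p3:
  fixes M1 :: "('a, 'm) monoid_scheme" and M2 :: "('b, 'n) monoid_scheme"
    and N :: "('c, 'k) monoid_scheme"
    and i1 :: "'c \<Rightarrow> 'a" and i2 :: "'c \<Rightarrow> 'b"
  assumes "E_unitary M1" and "E_unitary M2" and "inverse_monoid N"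
    and "i1 \<in> mon_hom N M1" and "inj_on i1 (carrier N)"
    and "i2 \<in> mon_hom N M2" and "inj_on i2 (carrier N)"
    and "i1 ` carrier N \<subseteq> Units M1" and "i2 ` carrier N \<subseteq> Units M2"
  shows "E_unitary (amalgam M1 M2 N i1 i2) \<and>
    (has_finite_special_presentation M1 \<and> has_finite_special_presentation M2 \<and> finitely_generated N
       \<longrightarrow> has_finite_special_presentation (amalgam M1 M2 N i1 i2))"
proof (intro conjI impI)
  show "E_unitary (amalgam M1 M2 N i1 i2)" by (rule E_unitary_amalgam[OF assms])
  assume pres: "has_finite_special_presentation M1 \<and> has_finite_special_presentation M2 \<and>
    finitely_generated N"
  show "has_finite_special_presentation (amalgam M1 M2 N i1 i2)"
    by (rule amalgam_finite_special_presentation[OF E_unitary.axioms(1)[OF assms(1)]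
          E_unitary.axioms(1)[OF assms(2)] assms(3,4,6,9)]) (simp_all add: pres)
qed

end
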